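(* As formal power series in $t$, $$NCM_{1324}(t,x,y)=NM_{1324}(t,x,y)=\left(\frac{1}{U_{1324}(t,y)}\right)^x,\qquad U_{1324}(t,y)=1+\sum_{n\ge 1}U_{1324,n}(y)\frac{t^n}{n!},$$ where $U_{1324,1}(y)=-y$ and for all $n\ge 2$, $$U_{1324,n}(y)=(1-y)U_{1324,n-1}(y)+\sum_{k=2}^{\lfloor\frac{n}{2}\rfloor}(-y)^{k-1}C_{k-1}\,U_{1324,n-2k+1}(y),$$ with $C_k=\frac{1}{k+1}\binom{2k}{k}$ the $k$-th Catalan number.
   Context: For a sequence $\sigma$ of distinct integers, $\mathrm{red}(\sigma)$ is the permutation obtained by replacing the $i$-th smallest integer appearing in $\sigma$ by $i$. For $\tau\in S_j$, a permutation $\sigma=\sigma_1\cdots\sigma_n\in S_n$ has a $\tau$-match starting at position $i$ if $\mathrm{red}(\sigma_i\sigma_{i+1}\cdots\sigma_{i+j-1})=\tau$. $\mathcal{NM}_n(\tau)$ is the set of $\sigma\in S_n$ with no $\tau$-matches. For a sequence $\sigma$, $\mathrm{des}(\sigma)=|\{i:\sigma_i>\sigma_{i+1}\}|$. An entry $\sigma_j$ is a left-to-right minimum if $\sigma_j<\sigma_i$ for all $i<j$ (so $\sigma_1$ is always one), and $\mathrm{LRmin}(\sigma)$ is their number. Set $$NM_\tau(t,x,y)=1+\sum_{n\ge1}\frac{t^n}{n!}\sum_{\sigma\in\mathcal{NM}_n(\tau)}x^{\mathrm{LRmin}(\sigma)}y^{1+\mathrm{des}(\sigma)}.$$ Cycles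 of a permutation are written $C=(c_0,c_1,\ldots,c_{q-1})$ with $c_0$ the smallest element. A permutation $\sigma\in S_n$ has a cycle-$\tau$-match, for $\tau\in S_j$, if some cycle $C=(c_0,\ldots,c_{q-1})$ of $\sigma$ has $q\ge j$ and there is an $r$ with $\mathrm{red}(c_rc_{r+1}\cdots c_{r+j-1})=\tau$, indices taken modulo $q$. $\mathcal{NCM}_n(\tau)$ is the set of $\sigma\in S_n$ with no cycle-$\tau$-matches. For a cycle, $\mathrm{cdes}(C)=1+\mathrm{des}(c_0c_1\cdots c_{q-1})$ (so $\mathrm{cdes}(C)=1$ if $q=1$), $\mathrm{cdes}(\sigma)$ is the sum of $\mathrm{cdes}$ over all cycles of $\sigma$, and $\mathrm{cyc}(\sigma)$ is the number of cycles. Set $$NCM_\tau(t,x,y)=1+\sum_{n\ge1}\frac{t^n}{n!}\sum_{\sigma\in\mathcal{NCM}_n(\tau)}x^{\mathrm{cyc}(\sigma)}y^{\mathrm{cdes}(\sigma)}.$$ For a power series $U$ in $t$ with constant term $1$, $(1/U)^x$ means $\exp(-x\log U)$ as a formal power series in $t$. *)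

theory Defs
  imports
    "HOL-Computational_Algebra.Formal_Power_Series"
    "HOL-Combinatorics.Combinatorics"
begin

text \<open>
  An element of \<open>S\<^sub>n\<close> is a function \<open>\<sigma>\<close> with \<open>\<sigma> permutes {1..n}\<close>; its one-line notation is the list
  \<open>one_line n \<sigma>\<close>. Patterns \<open>\<tau>\<close> are given directly in one-line notation, so \<open>1324\<close> is \<open>[1, 3, 2, 4]\<close>.
  List positions are counted from 0.
\<close>

definition one_line :: "nat \<Rightarrow> (nat \<Rightarrow> nat) \<Rightarrow> nat list" where
  "one_line n \<sigma> = map \<sigma> [1..<Suc n]"

definition red :: "nat list \<Rightarrow> nat list" where
  "red w = map (\<lambda>a. card {b \<in> set w. b \<le> a}) w"

definition match_at :: "nat list \<Rightarrow> nat list \<Rightarrow> nat \<Rightarrow> bool" where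
  "match_at \<tau> w i \<longleftrightarrow> i + length \<tau> \<le> length w \<and> red (take (length \<tau>) (drop i w)) = \<tau>"

definition NM_set :: "nat list \<Rightarrow> nat \<Rightarrow> (nat \<Rightarrow> nat) set" where
  "NM_set \<tau> n = {\<sigma>. \<sigma> permutes {1..n} \<and> \<not> (\<exists>i. match_at \<tau> (one_line n \<sigma>) i)}"

definition des :: "nat list \<Rightarrow> nat" where
  "des w = card {i. Suc i < length w \<and> w ! i > w ! Suc i}"

definition LRmin :: "nat list \<Rightarrow> nat" where
  "LRmin w = card {j. j < length w \<and> (\<forall>i<j. w ! j < w ! i)}"

text \<open>
  The generating functions are power series in \<open>t\<close> over an arbitrary field of characteristic 0
  containing \<open>x\<close> and \<open>y\<close>. Indeterminate \<open>x\<close> and \<open>y\<close> are the instance where that field is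
  \<open>rat poly poly fract\<close>.
\<close>

definition NM :: "nat list \<Rightarrow> 'a::field_char_0 \<Rightarrow> 'a \<Rightarrow> 'a fps" where
  "NM \<tau> x y = Abs_fps (\<lambda>n. if n = 0 then 1 else
     (\<Sum>\<sigma>\<in>NM_set \<tau> n. x ^ LRmin (one_line n \<sigma>) * y ^ (1 + des (one_line n \<sigma>))) / fact n)"

text \<open>
  \<open>support \<sigma> c\<close> is the list \<open>[c, \<sigma> c, \<sigma> (\<sigma> c), \<dots>]\<close> running once through the cycle of \<open>c\<close>. Every
  cycle, fixed points included, is represented by the one such list that starts with its smallest
  element.
\<close>

definition cycles_of :: "nat \<Rightarrow> (nat \<Rightarrow> nat) \<Rightarrow> nat list set" where
  "cycles_of n \<sigma> = {support \<sigma> c |c. c \<in> {1..n} \<and> (\<forall>d\<in>set (support \<sigma> c). c \<le> d)}"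

definition cycle_match_at :: "nat list \<Rightarrow> nat list \<Rightarrow> nat \<Rightarrow> bool" where
  "cycle_match_at \<tau> C r \<longleftrightarrow> length \<tau> \<le> length C \<and>
     red (map (\<lambda>i. C ! ((r + i) mod length C)) [0..<length \<tau>]) = \<tau>"

definition NCM_set :: "nat list \<Rightarrow> nat \<Rightarrow> (nat \<Rightarrow> nat) set" where
  "NCM_set \<tau> n =
     {\<sigma>. \<sigma> permutes {1..n} \<and> \<not> (\<exists>C\<in>cycles_of n \<sigma>. \<exists>r. cycle_match_at \<tau> C r)}"

definition cyc :: "nat \<Rightarrow> (nat \<Rightarrow> nat) \<Rightarrow> nat" where
  "cyc n \<sigma> = card (cycles_of n \<sigma>)"

definition cdes :: "nat \<Rightarrow> (nat \<Rightarrow> nat) \<Rightarrow> nat" where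
  "cdes n \<sigma> = (\<Sum>C\<in>cycles_of n \<sigma>. 1 + des C)"

definition NCM :: "nat list \<Rightarrow> 'a::field_char_0 \<Rightarrow> 'a \<Rightarrow> 'a fps" where
  "NCM \<tau> x y = Abs_fps (\<lambda>n. if n = 0 then 1 else
     (\<Sum>\<sigma>\<in>NCM_set \<tau> n. x ^ cyc n \<sigma> * y ^ cdes n \<sigma>) / fact n)"

text \<open>
  \<open>fps_ln 1\<close> is the series of \<open>log (1 + t)\<close>, so \<open>fps_log U\<close> is \<open>log U\<close>; this is meaningful only
  for \<open>U\<close> with constant term 1.
\<close>

definition fps_log :: "'a::field_char_0 fps \<Rightarrow> 'a fps" where
  "fps_log U = fps_ln 1 oo (U - 1)"

text \<open>\<open>(1/U)\<^sup>x\<close>, that is, \<open>exp (- x log U)\<close>\<close>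

definition fps_recip_power :: "'a::field_char_0 fps \<Rightarrow> 'a \<Rightarrow> 'a fps" where
  "fps_recip_power U x = fps_exp 1 oo (- fps_const x * fps_log U)"

definition catalan :: "nat \<Rightarrow> 'a::field_char_0" where
  "catalan k = 1 / of_nat (k + 1) * of_nat ((2 * k) choose k)"

text \<open>The value at 0 is the constant term of the power series.\<close>

function U1324_coeff :: "'a::field_char_0 \<Rightarrow> nat \<Rightarrow> 'a" where
  "U1324_coeff y 0 = 1"
| "U1324_coeff y (Suc 0) = - y"
| "n \<ge> 2 \<Longrightarrow> U1324_coeff y n = (1 - y) * U1324_coeff y (n - 1) +
     (\<Sum>k = 2..n div 2. (- y) ^ (k - 1) * catalan (k - 1) * U1324_coeff y (n - 2 * k + 1))"
proof goal_cases
  case (1 P p)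
  obtain y n where p: "p = (y, n)" by (cases p)
  consider "n = 0" | "n = Suc 0" | "n \<ge> 2" by linarith
  then show ?case using 1 p by cases blast+
qed auto
termination
  by (relation "measure snd") auto

definition U1324 :: "'a::field_char_0 \<Rightarrow> 'a fps" where
  "U1324 y = Abs_fps (\<lambda>n. U1324_coeff y n / fact n)"

end

theory Submission
  imports Defs
begin

text \<open>
  Both generating functions are exponential generating functions of the same numbers, and these satisfy a
  linear differential equation in \<open>t\<close> which \<open>(1/U)\<^sup>x\<close> satisfies as well.

  \<^emph>\<open>Dependence on \<open>x\<close>.\<close> The pattern 1324 starts with its smallest letter,
  so a match never contains a letter smaller than its first one. Cut a word at its smallest letter,
  \<open>w = u a v\<close>. Then every match lies inside \<open>u\<close> or inside \<open>a v\<close>,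
  the letter \<open>a\<close> is one new left-to-right minimum after those of \<open>u\<close>, and, if
  \<open>u\<close> is nonempty, it ends a descent. Hence the weights multiply, and the series
  \<open>N\<close> of the words satisfies \<open>N' = x K N\<close>, where \<open>K\<close> counts the
  words \<open>a v\<close> and does not depend on \<open>x\<close> (\<open>fps_deriv_egf_lr_wt\<close>).
  For permutations, the cycle of the smallest element plays the part of \<open>a v\<close> and the other
  cycles that of \<open>u\<close>; since a cycle match cannot wrap around the minimum of its cycle, the
  weight of \<open>a v\<close> is the same. So both families satisfy the same recursion and \<open>NCM =
  NM\<close> (\<open>sum_cycles_eq_sum_lr_wt\<close>). It remains to identify \<open>K\<close>, which is
  done at \<open>x = 1\<close>: once \<open>N U = 1\<close> is known there, \<open>U' = - K U\<close>, so
  \<open>exp (- x log U)\<close> solves the same equation with the same constant term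
  (\<open>egf_lr_wt_eq_recip_power\<close>).

  \<^emph>\<open>The reciprocal at \<open>x = 1\<close>.\<close> By the cluster method, \<open>1/N\<close>
  is the generating function of signed clusters. Give each letter the weight \<open>y\<close> and each
  ascent the weight \<open>1/y = 1 + (1/y - 1)\<close>, and treat a 1324-match as a forbidden factor of
  weight \<open>1 + (- 1)\<close>. A cluster is a word with marked ascents and marked matches such that
  every adjacency is covered by a mark. A descent can be covered only as the middle of a match, so all
  matches of a cluster are marked, and minus the sum over the markings of a word, which is its coefficient
  in \<open>1/N\<close>, is \<open>(- y)\<close> to the number of descents plus one, times \<open>1 -
  y\<close> for every ascent outside the matches. This weight obeys a recursion on the first letters
  (\<open>cluster_wt\<close>), and with it the alternating sum over all ways to cut a word in two vanishes
  (\<open>sum_avoid_cluster_cut\<close>).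

  \<^emph>\<open>The recursion for \<open>U\<close>.\<close> A cluster starts with its smallest letter 0.
  If its second letter is \<open>j \<ge> 2\<close>, it starts with a match; deleting 0 and
  \<open>j\<close> leaves a cluster of the same kind (\<open>cluster_sum2_rec\<close>), and the permitted
  values of the new second letter are those at least \<open>j - 1\<close>. Iterating this rule counts
  ballot paths, so the coefficients are ballot numbers (\<open>cluster_sum2_eq\<close>), and summing over
  \<open>j\<close> gives the Catalan numbers (\<open>cluster_sum_rec\<close>).
\<close>

unbundle fps_syntax

section \<open>Sums over the words on a finite set of letters\<close>

lemma permutations_of_set_iff: "w \<in> permutations_of_set A \<longleftrightarrow> set w = A \<and> distinct w"
  by (auto simp: permutations_of_set_def)

lemma sum_words_Cons:
  fixes \<phi> :: "'b list \<Rightarrow> 'a::comm_monoid_add"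
  assumes "finite A" "A \<noteq> {}"
  shows "(\<Sum>w\<in>permutations_of_set A. \<phi> w) =
         (\<Sum>a\<in>A. \<Sum>v\<in>permutations_of_set (A - {a}). \<phi> (a # v))"
proof -
  have "(\<Sum>w\<in>permutations_of_set A. \<phi> w) =
        (\<Sum>a\<in>A. \<Sum>w\<in>(#) a ` permutations_of_set (A - {a}). \<phi> w)"
    unfolding permutations_of_set_nonempty[OF assms(2)]
    by (rule sum.UNION_disjoint) (use assms in auto)
  also have "\<dots> = (\<Sum>a\<in>A. \<Sum>v\<in>permutations_of_set (A - {a}). \<phi> (a # v))"
    by (simp add: sum.reindex)
  finally show ?thesis .
qed

text \<open>
  Cutting a word on \<open>A\<close> after its first \<open>k\<close> letters amounts to choosing the set
  \<open>B\<close> of these letters and ordering \<open>B\<close> and \<open>A - B\<close> separately.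
  This turns identities between words into products of exponential generating functions.
\<close>

lemma sum_words_cut:
  fixes \<phi> :: "'b list \<Rightarrow> 'b list \<Rightarrow> 'a::comm_monoid_add"
  assumes "finite A"
  shows "(\<Sum>w\<in>permutations_of_set A. \<Sum>k\<le>length w. \<phi> (take k w) (drop k w)) =
         (\<Sum>B\<in>Pow A. \<Sum>u\<in>permutations_of_set B. \<Sum>v\<in>permutations_of_set (A - B). \<phi> u v)"
proof -
  have fin: "finite B" if "B \<in> Pow A" for B
    using that assms finite_subset by auto
  have "(\<Sum>w\<in>permutations_of_set A. \<Sum>k\<le>length w. \<phi> (take k w) (drop k w)) =
        (\<Sum>(w, k)\<in>Sigma (permutations_of_set A) (\<lambda>w. {..length w}). \<phi> (take k w) (drop k w))"
    using assms by (subst sum.Sigma) auto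
  also have "\<dots> = (\<Sum>(B, u, v)\<in>Sigma (Pow A) (\<lambda>B. permutations_of_set B \<times> permutations_of_set (A - B)). \<phi> u v)"
    by (rule sum.reindex_bij_witness[where
          i = "\<lambda>(B, u, v). (u @ v, length u)" and
          j = "\<lambda>(w, k). (set (take k w), take k w, drop k w)"])
       (auto simp: permutations_of_set_iff set_take_subset set_drop_subset
          dest: in_set_takeD in_set_dropD
          intro: distinct_take distinct_drop,
        (metis append_take_drop_id Un_iff set_append 
           disjoint_iff distinct_append)+)
  also have "\<dots> = (\<Sum>B\<in>Pow A. \<Sum>u\<in>permutations_of_set B. \<Sum>v\<in>permutations_of_set (A - B). \<phi> u v)"
    using assms fin by (subst sum.Sigma[symmetric]) (auto simp: sum.cartesian_product)
  finally show ?thesis .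
qed

lemma sum_words_around:
  fixes \<phi> :: "'b list \<Rightarrow> 'a::comm_monoid_add"
  assumes "finite A" "a \<in> A"
  shows "(\<Sum>w\<in>permutations_of_set A. \<phi> w) =
         (\<Sum>B\<in>Pow (A - {a}). \<Sum>u\<in>permutations_of_set B.
            \<Sum>v\<in>permutations_of_set (A - {a} - B). \<phi> (u @ a # v))"
proof -
  have cut: "takeWhile (\<lambda>b. b \<noteq> a) (u @ a # v) = u \<and> dropWhile (\<lambda>b. b \<noteq> a) (u @ a # v) = a # v"
    if "a \<notin> set u" for u v
    using that by (induction u) auto
  have "(\<Sum>(B, u, v)\<in>Sigma (Pow (A - {a})) (\<lambda>B. permutations_of_set B \<times> permutations_of_set (A - {a} - B)). \<phi> (u @ a # v)) = (\<Sum>w\<in>permutations_of_set A. \<phi> w)"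
    (is "?L = _")
  proof (rule sum.reindex_bij_witness[where
          j = "\<lambda>(B, u, v). u @ a # v" and
          i = "\<lambda>w. (set (takeWhile (\<lambda>b. b \<noteq> a) w), takeWhile (\<lambda>b. b \<noteq> a) w, tl (dropWhile (\<lambda>b. b \<noteq> a) w))"], goal_cases)
    case (1 p)
    then obtain u v where p: "p = (set u, u, v)" and "set u \<subseteq> A - {a}"
      by (auto simp: permutations_of_set_iff)
    then have "a \<notin> set u" by blast
    then show ?case
      using p by (simp add: cut)
  next
    case (3 w)
    then have "a \<in> set w"
      using assms by (auto simp: permutations_of_set_iff)
    then obtain u v where "w = u @ a # v" "a \<notin> set u"
      by (meson split_list_first)
    with 3 show ?case
      by (auto simp: permutations_of_set_iff cut)
  next
    case (4 w)
    then have "a \<in> set w"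
      using assms by (auto simp: permutations_of_set_iff)
    then obtain u v where "w = u @ a # v" "a \<notin> set u"
      by (meson split_list_first)
    with 4 show ?case
      by (auto simp: permutations_of_set_iff cut)
  qed (use assms in \<open>auto simp: permutations_of_set_iff\<close>)
  moreover have "?L = (\<Sum>B\<in>Pow (A - {a}). \<Sum>u\<in>permutations_of_set B.
            \<Sum>v\<in>permutations_of_set (A - {a} - B). \<phi> (u @ a # v))"
    using assms by (subst sum.Sigma[symmetric]) (auto simp: sum.cartesian_product)
  ultimately show ?thesis by simp
qed

text \<open>
  Weights that see only the relative order of the letters. Their sum over the words on \<open>A\<close>
  depends on \<open>A\<close> through \<open>card A\<close> alone, which replaces the standardization of
  words. Monotonicity is required only on the letters of the word, because the order isomorphism from an
  initial segment to \<open>A\<close> has no canonical extension to all numbers.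
\<close>

definition order_invariant :: "(nat list \<Rightarrow> 'a) \<Rightarrow> bool" where
  "order_invariant f \<longleftrightarrow> (\<forall>h w. strict_mono_on (set w) h \<longrightarrow> f (map h w) = f w)"

lemma order_invariantD:
  "order_invariant f \<Longrightarrow> strict_mono_on (set w) h \<Longrightarrow> f (map h w) = f w"
  by (simp add: order_invariant_def)

lemma sum_words_map:
  fixes h :: "nat \<Rightarrow> nat"
  assumes "strict_mono_on A h"
  shows "(\<Sum>w\<in>permutations_of_set (h ` A). \<phi> w) = (\<Sum>w\<in>permutations_of_set A. \<phi> (map h w))"
proof -
  have inj: "inj_on h A"
    using assms strict_mono_on_imp_inj_on by blast
  then have "inj_on (map h) (permutations_of_set A)"
    by (auto intro!: inj_onI simp: permutations_of_set_iff inj_on_map_eq_map)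
  with inj show ?thesis
    by (simp add: permutations_of_set_image_inj sum.reindex)
qed

lemma sum_words_card:
  fixes f :: "nat list \<Rightarrow> 'a::comm_monoid_add"
  assumes "order_invariant f" "finite A"
  shows "(\<Sum>w\<in>permutations_of_set A. f w) = (\<Sum>w\<in>permutations_of_set {..<card A}. f w)"
proof -
  let ?l = "sorted_list_of_set A"
  define h where "h = (!) ?l"
  have sm: "strict_mono_on {..<card A} h"
    using strict_sorted_list_of_set[of A]
    by (auto intro!: strict_mono_onI simp: h_def sorted_wrt_iff_nth_less)
  have "h ` {..<card A} = set ?l"
    unfolding h_def set_conv_nth by (auto simp: assms)
  then have im: "h ` {..<card A} = A"
    using assms by simp
  have "(\<Sum>w\<in>permutations_of_set A. f w) = (\<Sum>w\<in>permutations_of_set {..<card A}. f (map h w))"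
    using sum_words_map[OF sm, of f] by (simp add: im)
  also have "\<dots> = (\<Sum>w\<in>permutations_of_set {..<card A}. f w)"
    by (intro sum.cong refl order_invariantD[OF assms(1)])
       (use sm in \<open>auto simp: permutations_of_set_iff\<close>)
  finally show ?thesis .
qed

definition egf :: "(nat list \<Rightarrow> 'a::field_char_0) \<Rightarrow> 'a fps" where
  "egf f = Abs_fps (\<lambda>n. (\<Sum>w\<in>permutations_of_set {..<n}. f w) / fact n)"

lemma sum_words_egf:
  assumes "order_invariant f" "finite A"
  shows "(\<Sum>w\<in>permutations_of_set A. f w) = fact (card A) * egf f $ card A"
  using sum_words_card[OF assms] by (simp add: egf_def)

text \<open>
  The product formula for exponential generating functions: grouping the subsets \<open>B\<close> by their
  size produces the binomial coefficients.
\<close>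

lemma sum_words_egf_mult:
  assumes "order_invariant f" "order_invariant g" "finite A"
  shows "(\<Sum>B\<in>Pow A. (\<Sum>u\<in>permutations_of_set B. f u) * (\<Sum>v\<in>permutations_of_set (A - B). g v)) =
         fact (card A) * (egf f * egf g) $ card A"
proof -
  let ?n = "card A"
  let ?F = "\<lambda>k. fact k * egf f $ k" and ?G = "\<lambda>k. fact k * egf g $ k"
  have "(\<Sum>B\<in>Pow A. (\<Sum>u\<in>permutations_of_set B. f u) * (\<Sum>v\<in>permutations_of_set (A - B). g v)) =
        (\<Sum>B\<in>Pow A. ?F (card B) * ?G (?n - card B))"
  proof (rule sum.cong[OF refl])
    fix B assume "B \<in> Pow A"
    then have "finite B"
      using assms(3) by (auto intro: finite_subset)
    moreover from this \<open>B \<in> Pow A\<close> have "card (A - B) = ?n - card B"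
      by (simp add: card_Diff_subset)
    ultimately show "(\<Sum>u\<in>permutations_of_set B. f u) * (\<Sum>v\<in>permutations_of_set (A - B). g v) =
        ?F (card B) * ?G (?n - card B)"
      using assms by (simp add: sum_words_egf)
  qed
  also have "\<dots> = (\<Sum>k\<le>?n. \<Sum>B\<in>{B\<in>Pow A. card B = k}. ?F (card B) * ?G (?n - card B))"
    by (rule sum.group[symmetric]) (use assms card_mono in auto)
  also have "\<dots> = (\<Sum>k\<le>?n. of_nat (?n choose k) * (?F k * ?G (?n - k)))"
    using assms by (auto intro!: sum.cong simp: n_subsets)
  also have "\<dots> = (\<Sum>k\<le>?n. fact ?n * (egf f $ k * egf g $ (?n - k)))"
    by (intro sum.cong refl) (simp add: binomial_fact field_simps)
  also have "\<dots> = fact ?n * (egf f * egf g) $ ?n"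
    by (simp add: fps_mult_nth sum_distrib_left atLeast0AtMost)
  finally show ?thesis .
qed

section \<open>Words without 1324-matches\<close>

fun starts_1324 :: "nat list \<Rightarrow> bool" where
  "starts_1324 (a # b # c # d # r) \<longleftrightarrow> a < c \<and> c < b \<and> b < d"
| "starts_1324 _ \<longleftrightarrow> False"

text \<open>
  If a letter repeats, at most three are different, so none has rank 4 and both sides are false.
\<close>

lemma red_eq_1324_iff: "red [a, b, c, d] = [1, 3, 2, 4] \<longleftrightarrow> a < c \<and> c < b \<and> b < d"
proof
  assume red: "red [a, b, c, d] = [1, 3, 2, 4]"
  define r where "r = (\<lambda>e. card {e' \<in> {a, b, c, d}. e' \<le> e})"
  have mono: "r e \<le> r e'" if "e \<le> e'" for e e'
    unfolding r_def using that by (intro card_mono) auto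
  from red have "r a = 1" "r b = 3" "r c = 2" "r d = 4"
    by (auto simp: red_def r_def)
  then show "a < c \<and> c < b \<and> b < d"
    using mono[of c a] mono[of b c] mono[of d b] by (auto simp: not_le[symmetric])
next
  assume "a < c \<and> c < b \<and> b < d"
  then have "{e \<in> {a, b, c, d}. e \<le> a} = {a}" "{e \<in> {a, b, c, d}. e \<le> b} = {a, c, b}"
    "{e \<in> {a, b, c, d}. e \<le> c} = {a, c}" "{e \<in> {a, b, c, d}. e \<le> d} = {a, c, b, d}" "a < c" "c < b" "b < d"
    by auto
  then show "red [a, b, c, d] = [1, 3, 2, 4]"
    by (simp add: red_def)
qed

lemma match_at_0_iff: "match_at [1, 3, 2, 4] w 0 \<longleftrightarrow> starts_1324 w"
  by (cases w rule: starts_1324.cases) (auto simp: match_at_def red_eq_1324_iff[simplified])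

lemma match_at_Suc_iff: "match_at \<tau> (a # w) (Suc i) \<longleftrightarrow> match_at \<tau> w i"
  by (simp add: match_at_def)

definition has_1324 :: "nat list \<Rightarrow> bool" where
  "has_1324 w \<longleftrightarrow> (\<exists>i. match_at [1, 3, 2, 4] w i)"

lemma has_1324_Nil [simp]: "\<not> has_1324 []"
  by (simp add: has_1324_def match_at_def)

lemma has_1324_Cons [simp]: "has_1324 (a # w) \<longleftrightarrow> starts_1324 (a # w) \<or> has_1324 w"
proof -
  have "(\<exists>i. P i) \<longleftrightarrow> P 0 \<or> (\<exists>i. P (Suc i))" for P
  proof
    assume "\<exists>i. P i"
    then obtain i where "P i" ..
    then show "P 0 \<or> (\<exists>i. P (Suc i))"
      by (cases i) auto
  qed blast
  from this[of "match_at [1, 3, 2, 4] (a # w)"] show ?thesis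
    unfolding match_at_0_iff match_at_Suc_iff has_1324_def .
qed

lemma des_Nil [simp]: "des [] = 0" and des_single [simp]: "des [a] = 0"
  by (simp_all add: des_def)

lemma des_Cons_Cons [simp]: "des (a # b # r) = of_bool (b < a) + des (b # r)"
proof -
  have "{i. Suc i < length (a # b # r) \<and> (a # b # r) ! i > (a # b # r) ! Suc i} =
    (if b < a then {0} else {}) \<union>
    Suc ` {i. Suc i < length (b # r) \<and> (b # r) ! i > (b # r) ! Suc i}"
    by (auto simp: image_iff gr0_conv_Suc less_Suc_eq_0_disj)
  then show ?thesis
    by (simp add: des_def card_image)
qed

text \<open>
  The weight \<open>y\<close> to the power of one plus the number of descents on nonempty words, and 0 if there is a
  match, in the recursive form that matches the recursion for clusters below. A match at the start needs
  an ascent there, hence the order of the tests.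
\<close>

fun avoid_wt :: "'a::field_char_0 \<Rightarrow> nat list \<Rightarrow> 'a" where
  "avoid_wt y [] = 1"
| "avoid_wt y [a] = y"
| "avoid_wt y (a # b # r) = (if b < a then y * avoid_wt y (b # r)
     else if starts_1324 (a # b # r) then 0 else avoid_wt y (b # r))"

lemma starts_1324_ascent: "starts_1324 (a # b # r) \<Longrightarrow> a < b"
  by (cases "a # b # r" rule: starts_1324.cases) auto

lemma avoid_wt_eq:
  "w \<noteq> [] \<Longrightarrow> avoid_wt y w = (if has_1324 w then 0 else y ^ (1 + des w))"
  by (induction y w rule: avoid_wt.induct) (auto dest: starts_1324_ascent)

text \<open>
  A match that used letters from both sides would contain \<open>a\<close> at a place other than its
  first, but there \<open>a\<close> would have to exceed a letter of \<open>u\<close>. The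
  \<open>1\<close> in the exponent of the second factor accounts for the descent from \<open>u\<close> to
  \<open>a\<close>.
\<close>

lemma avoid_wt_append_min:
  assumes "\<And>b. b \<in> set u \<Longrightarrow> a < b"
  shows "avoid_wt y (u @ a # v) = avoid_wt y u * avoid_wt y (a # v)"
  using assms
proof (induction y u rule: avoid_wt.induct)
  case (3 y b c r)
  have "starts_1324 ((b # c # r) @ a # v) \<longleftrightarrow> starts_1324 (b # c # r)" if "b < c"
    using 3(3) that
    by (cases "b # c # r" rule: starts_1324.cases; cases v) (auto dest: order.asym)
  with 3 show ?case
    using starts_1324_ascent by (auto simp del: starts_1324.simps)
qed auto

section \<open>Signed clusters\<close>

text \<open>
  The signed weight of a nonempty word as a cluster: 0 unless every descent is the middle of a match, and
  otherwise \<open>(- y)\<close> to the number of descents plus one, times \<open>1 - y\<close> for every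
  ascent outside all matches. In the case of a match \<open>a b c d\<close> at the start, deleting
  \<open>a\<close> and \<open>b\<close> exposes the ascent \<open>c d\<close>, which this match covers. If
  \<open>c d\<close> starts another match, it is covered anyway and \<open>d \<dots>\<close> starts with a
  descent, so that its weight is 0. If not, \<open>c d\<close> contributes the factor \<open>1 - y\<close>
  to the first summand, and the second summand corrects this factor to 1.
\<close>

fun cluster_wt :: "'a::field_char_0 \<Rightarrow> nat list \<Rightarrow> 'a" where
  "cluster_wt y [] = 1"
| "cluster_wt y [a] = - y"
| "cluster_wt y (a # b # r) = (if b < a then 0
     else if starts_1324 (a # b # r) then - y * (cluster_wt y r + y * cluster_wt y (tl r))
     else (1 - y) * cluster_wt y (b # r))"

lemma sum_cut_Cons:
  "(\<Sum>k\<le>length (a # w). \<phi> (take k (a # w)) (drop k (a # w))) =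
   \<phi> [] (a # w) + (\<Sum>k\<le>length w. \<phi> (a # take k w) (drop k w))"
  by (simp add: sum.atMost_Suc_shift del: sum.atMost_Suc)

lemma starts_1324_take:
  "starts_1324 (take k w) \<longleftrightarrow> 4 \<le> k \<and> starts_1324 w"
  by (cases w rule: starts_1324.cases; cases k rule: nat.exhaust)
    (auto simp: take_Cons' numeral_eq_Suc split: if_splits)

text \<open>
  The cancellation behind the cluster method. By induction the sum vanishes for the word without its first
  letter \<open>a\<close>. Prepending \<open>a\<close> to a nonempty left part multiplies its weight by
  \<open>y\<close> (descent) or by 1 (ascent), except that the weight becomes 0 once the left part
  contains a match at the start. What is left over cancels by the recursion for the cluster weight.
\<close>

lemma sum_avoid_cluster_cut:
  "w \<noteq> [] \<Longrightarrow> (\<Sum>k\<le>length w. avoid_wt y (take k w) * cluster_wt y (drop k w)) = 0"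
proof (induction w rule: length_induct)
  case (1 w)
  let ?h = "\<lambda>w. \<Sum>k\<le>length w. avoid_wt y (take k w) * cluster_wt y (drop k w)"
  consider a where "w = [a]" | a b r where "w = a # b # r"
    using 1(2) by (metis list.exhaust)
  then show ?case
  proof cases
    case 1
    then show ?thesis by simp
  next
    case 2
    have IH: "?h (b # r) = 0"
      using 1(1)[rule_format, of "b # r"] 2 by (simp del: sum.atMost_Suc)
    \<comment> \<open>the part of the sum for \<open>b # r\<close> with a nonempty left part\<close>
    define S where "S = (\<Sum>k\<le>length r. avoid_wt y (b # take k r) * cluster_wt y (drop k r))"
    have S: "S = - cluster_wt y (b # r)"
      using IH unfolding S_def sum_cut_Cons[of "\<lambda>u v. avoid_wt y u * cluster_wt y v"]
      by (simp add: eq_neg_iff_add_eq_0 add.commute)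
    have h: "?h w = cluster_wt y w + y * cluster_wt y (b # r) +
        (\<Sum>k\<le>length r. avoid_wt y (a # b # take k r) * cluster_wt y (drop k r))"
      unfolding 2 sum_cut_Cons[of "\<lambda>u v. avoid_wt y u * cluster_wt y v"]
        sum_cut_Cons[of "\<lambda>u v. avoid_wt y (a # u) * cluster_wt y v"] by simp
    consider "b < a" | "a \<le> b" "\<not> starts_1324 w" | "starts_1324 w"
      by linarith
    then show ?thesis
    proof cases
      case 1
      then have "(\<Sum>k\<le>length r. avoid_wt y (a # b # take k r) * cluster_wt y (drop k r)) = y * S"
        by (simp add: S_def sum_distrib_left mult.assoc)
      with 1 show ?thesis
        unfolding h S by (simp add: 2)
    next
      case b: 2
      have "\<not> starts_1324 (a # b # take k r)" for k
        using b(2) starts_1324_take[of "Suc (Suc k)" w] by (auto simp: 2)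
      with b have "(\<Sum>k\<le>length r. avoid_wt y (a # b # take k r) * cluster_wt y (drop k r)) = S"
        by (simp add: S_def)
      with b show ?thesis
        unfolding h S by (simp add: 2 algebra_simps)
    next
      case 3
      then obtain c d r' where r: "r = c # d # r'" and lt: "a < c" "c < b" "b < d"
        unfolding 2 by (cases "a # b # r" rule: starts_1324.cases) auto
      \<comment> \<open>Left parts of length 4 or more contain the match. Of the shorter ones, \<open>a b\<close> has weight \<open>y\<close> and
        \<open>a b c\<close> has weight \<open>y\<^sup>2\<close>; the cut after \<open>a\<close> leaves \<open>b c \<dots>\<close>, an uncovered descent.\<close>
      have "(\<Sum>k\<le>length r. avoid_wt y (a # b # take k r) * cluster_wt y (drop k r)) =
            y * cluster_wt y r + y\<^sup>2 * cluster_wt y (d # r')"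
        using lt by (simp add: r sum.atMost_Suc_shift power2_eq_square del: sum.atMost_Suc)
      with lt show ?thesis
        unfolding h by (simp add: 2 r power2_eq_square algebra_simps)
    qed
  qed
qed

lemma starts_1324_map:
  "strict_mono_on (set w) h \<Longrightarrow> starts_1324 (map h w) \<longleftrightarrow> starts_1324 w"
  by (cases w rule: starts_1324.cases) (auto simp: strict_mono_on_less)

lemma order_invariant_avoid_wt: "order_invariant (avoid_wt y)"
  unfolding order_invariant_def
proof (intro allI impI)
  fix h :: "nat \<Rightarrow> nat" and w assume "strict_mono_on (set w) h"
  then show "avoid_wt y (map h w) = avoid_wt y w"
  proof (induction y w rule: avoid_wt.induct)
    case (3 y a b r)
    moreover have "strict_mono_on (set (b # r)) h"
      by (rule monotone_on_subset[OF 3(3)]) auto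
    ultimately show ?case
      using starts_1324_map[OF 3(3)] by (simp add: strict_mono_on_less del: starts_1324.simps)
  qed auto
qed

lemma order_invariant_cluster_wt: "order_invariant (cluster_wt y)"
  unfolding order_invariant_def
proof (intro allI impI)
  fix h :: "nat \<Rightarrow> nat" and w assume "strict_mono_on (set w) h"
  then show "cluster_wt y (map h w) = cluster_wt y w"
  proof (induction y w rule: cluster_wt.induct)
    case (3 y a b r)
    moreover have "strict_mono_on (set (b # r)) h" "strict_mono_on (set r) h"
      "strict_mono_on (set (tl r)) h"
      by (rule monotone_on_subset[OF 3(4)], cases r, auto)+
    ultimately show ?case
      using starts_1324_map[OF 3(4)]
      by (simp add: strict_mono_on_less[OF 3(4)] flip: map_tl del: starts_1324.simps)
  qed auto
qed

lemma egf_avoid_cluster: "egf (avoid_wt y) * egf (cluster_wt y) = 1"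
proof (rule fps_ext)
  fix n
  have "fact n * (egf (avoid_wt y) * egf (cluster_wt y)) $ n =
    (\<Sum>w\<in>permutations_of_set {..<n}.
       \<Sum>k\<le>length w. avoid_wt y (take k w) * cluster_wt y (drop k w))"
    using sum_words_egf_mult[OF order_invariant_avoid_wt order_invariant_cluster_wt, of "{..<n}" y y]
    by (simp add: sum_words_cut[where \<phi> = "\<lambda>u v. avoid_wt y u * cluster_wt y v"] sum_product)
  also have "\<dots> = of_bool (n = 0)"
  proof (cases "n = 0")
    case False
    have "(\<Sum>k\<le>length w. avoid_wt y (take k w) * cluster_wt y (drop k w)) = 0"
      if "w \<in> permutations_of_set {..<n}" for w
    proof (rule sum_avoid_cluster_cut)
      from that have "length w = n"
        using length_finite_permutations_of_set by fastforce
      with False show "w \<noteq> []"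
        by (cases w) simp_all
    qed
    with False show ?thesis
      by simp
  qed simp
  finally show "(egf (avoid_wt y) * egf (cluster_wt y)) $ n = 1 $ n"
    by (cases "n = 0") auto
qed

section \<open>The sum over signed clusters\<close>

text \<open>
  In a word of nonzero weight a descent is the middle of a match, so its lower letter still exceeds the
  letter before the descent; hence no letter falls below the first one.
\<close>

lemma cluster_wt_min_first:
  "cluster_wt y w \<noteq> 0 \<Longrightarrow> b \<in> set w \<Longrightarrow> hd w \<le> b"
proof (induction y w arbitrary: b rule: cluster_wt.induct)
  case (3 y a c r)
  show ?case
  proof (cases "starts_1324 (a # c # r)")
    case True
    then obtain d e r' where r: "r = d # e # r'" and lt: "a < d" "d < c" "c < e"
      by (cases "a # c # r" rule: starts_1324.cases) auto
    have "cluster_wt y r \<noteq> 0 \<or> cluster_wt y (tl r) \<noteq> 0"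
      using 3(4) True by (auto split: if_splits)
    then show ?thesis
      using 3(1)[of b] 3(2)[of b] 3(5) True lt by (auto simp: r)
  next
    case False
    then show ?thesis
      using 3 by (force split: if_splits simp del: starts_1324.simps)
  qed
qed auto

lemma cluster_wt_eq_0: "b \<in> set w \<Longrightarrow> b < hd w \<Longrightarrow> cluster_wt y w = 0"
  using cluster_wt_min_first[of y w b] by auto

lemma sum_cluster_min_first:
  assumes "finite A" "m \<in> A" "\<And>a. a \<in> A \<Longrightarrow> m \<le> a"
  shows "(\<Sum>w\<in>permutations_of_set A. cluster_wt y w) =
         (\<Sum>v\<in>permutations_of_set (A - {m}). cluster_wt y (m # v))"
proof -
  have "(\<Sum>v\<in>permutations_of_set (A - {a}). cluster_wt y (a # v)) = 0" if "a \<in> A - {m}" for a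
  proof (intro sum.neutral ballI)
    fix v assume "v \<in> permutations_of_set (A - {a})"
    then show "cluster_wt y (a # v) = 0"
      using that assms(2) assms(3)[of a]
      by (intro cluster_wt_eq_0[of m]) (auto simp: permutations_of_set_iff)
  qed
  moreover have "(\<Sum>w\<in>permutations_of_set A. cluster_wt y w) =
        (\<Sum>a\<in>A. \<Sum>v\<in>permutations_of_set (A - {a}). cluster_wt y (a # v))"
    using assms by (intro sum_words_Cons) auto
  ultimately show ?thesis
    using assms by (simp add: sum.remove)
qed

definition cluster_sum :: "'a::field_char_0 \<Rightarrow> nat \<Rightarrow> 'a" where
  "cluster_sum y n = (\<Sum>w\<in>permutations_of_set {..<n}. cluster_wt y w)"

text \<open>
  The share of the words that start with \<open>0 j\<close>; by \<open>cluster_wt_min_first\<close> the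
  first letter has to be 0.
\<close>

definition cluster_sum2 :: "'a::field_char_0 \<Rightarrow> nat \<Rightarrow> nat \<Rightarrow> 'a" where
  "cluster_sum2 y n j = (\<Sum>v\<in>permutations_of_set ({..<n} - {0, j}). cluster_wt y (0 # j # v))"

lemma cluster_sum_from_1:
  assumes "n > 1"
  shows "(\<Sum>v\<in>permutations_of_set ({..<n} - {0, 1}). cluster_wt y (1 # v)) = cluster_sum y (n - 1)"
proof -
  have "cluster_sum y (n - 1) = (\<Sum>w\<in>permutations_of_set {1..<n}. cluster_wt y w)"
    using sum_words_card[OF order_invariant_cluster_wt, of "{1..<n}" y]
    by (simp add: cluster_sum_def)
  also have "\<dots> = (\<Sum>v\<in>permutations_of_set ({1..<n} - {1}). cluster_wt y (1 # v))"
    using assms by (intro sum_cluster_min_first) auto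
  also have "{1..<n} - {1} = {..<n} - {0, 1}"
    by auto
  finally show ?thesis by simp
qed

lemma cluster_wt_0_1: "cluster_wt y (0 # 1 # v) = (1 - y) * cluster_wt y (1 # v)"
  by (cases "0 # Suc 0 # v" rule: starts_1324.cases) auto

lemma cluster_sum2_1:
  assumes "n > 1"
  shows "cluster_sum2 y n 1 = (1 - y) * cluster_sum y (n - 1)"
  unfolding cluster_sum2_def cluster_wt_0_1 sum_distrib_left[symmetric]
  by (simp only: cluster_sum_from_1[OF assms])

lemma cluster_sum_eq_sum2:
  assumes "n > 1"
  shows "cluster_sum y n = (1 - y) * cluster_sum y (n - 1) + (\<Sum>j\<in>{2..<n}. cluster_sum2 y n j)"
proof -
  have "cluster_sum y n = (\<Sum>v\<in>permutations_of_set ({..<n} - {0}). cluster_wt y (0 # v))"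
    unfolding cluster_sum_def using assms by (intro sum_cluster_min_first) auto
  also have "\<dots> = (\<Sum>j\<in>{..<n} - {0}. \<Sum>v\<in>permutations_of_set ({..<n} - {0} - {j}). cluster_wt y (0 # j # v))"
  proof (rule sum_words_Cons)
    have "1 \<in> {..<n} - {0}" using assms by auto
    then show "{..<n} - {0} \<noteq> {}" by blast
  qed auto
  also have "\<dots> = (\<Sum>j\<in>{..<n} - {0}. cluster_sum2 y n j)"
    by (simp add: cluster_sum2_def Diff_insert[symmetric] insert_commute)
  also have "{..<n} - {0} = insert 1 {2..<n}"
    using assms by auto
  finally show ?thesis
    using assms by (simp add: cluster_sum2_1[simplified])
qed

lemma cluster_wt_Cons_match:
  "starts_1324 (a # b # r) \<Longrightarrow>
   cluster_wt y (a # b # r) = - y * (cluster_wt y r + y * cluster_wt y (tl r))"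
  using starts_1324_ascent[of a b r] by (simp del: starts_1324.simps)

lemma cluster_wt_Cons_free:
  "a \<le> b \<Longrightarrow> \<not> starts_1324 (a # b # r) \<Longrightarrow> cluster_wt y (a # b # r) = (1 - y) * cluster_wt y (b # r)"
  by (simp del: starts_1324.simps)

text \<open>
  The map \<open>h\<close> renames the letters \<open>0, 1, 2, \<dots>\<close> in increasing order to the
  letters other than 0 and \<open>j\<close>. A word \<open>0 j \<dots>\<close> with \<open>j \<ge>
  2\<close> has nonzero weight only if it starts with a match, because otherwise \<open>j\<close> would
  have to be the smallest letter of the rest, which contains 1. The match means \<open>h c < j < h
  d\<close>.
\<close>

lemma cluster_wt_skip:
  assumes j: "2 \<le> j" and u: "0 \<in> set (c # d # r)"
  defines "h \<equiv> \<lambda>i. if i + 1 < j then i + 1 else i + 2"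
  shows "cluster_wt y (0 # j # map h (c # d # r)) =
    (if c = 0 \<and> j \<le> d + 1 then - y * (cluster_wt y (c # d # r) + y * cluster_wt y (d # r)) else 0)"
proof (cases "h c < j \<and> j < h d")
  case False
  then have "\<not> starts_1324 (0 # j # map h (c # d # r))"
    by simp
  then have "cluster_wt y (0 # j # map h (c # d # r)) = (1 - y) * cluster_wt y (j # map h (c # d # r))"
    by (intro cluster_wt_Cons_free) simp
  moreover have "1 \<in> set (j # map h (c # d # r))"
    using u j by (force simp: h_def image_iff)
  then have "cluster_wt y (j # map h (c # d # r)) = 0"
    using j by (intro cluster_wt_eq_0[of 1]) simp_all
  moreover have "\<not> (c = 0 \<and> j \<le> d + 1)"
  proof
    assume "c = 0 \<and> j \<le> d + 1"
    with j have "h c = 1" "h d = d + 2"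
      by (simp_all add: h_def)
    with False j \<open>c = 0 \<and> j \<le> d + 1\<close> show False
      by simp
  qed
  ultimately show ?thesis by (simp only: if_False mult_zero_right)
next
  case True
  have sm: "strict_mono_on X h" for X
    by (auto intro!: strict_mono_onI simp: h_def)
  have "0 < h c" by (simp add: h_def)
  with True have "starts_1324 (0 # j # map h (c # d # r))"
    by simp
  then have "cluster_wt y (0 # j # map h (c # d # r)) =
      - y * (cluster_wt y (map h (c # d # r)) + y * cluster_wt y (map h (d # r)))"
    by (simp only: cluster_wt_Cons_match list.map list.sel)
  also have "\<dots> = - y * (cluster_wt y (c # d # r) + y * cluster_wt y (d # r))"
    by (simp only: order_invariantD[OF order_invariant_cluster_wt sm])
  finally have eq: "cluster_wt y (0 # j # map h (c # d # r)) = \<dots>" .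
  have d: "j \<le> d + 1"
  proof (rule ccontr)
    assume "\<not> j \<le> d + 1"
    then have "h d = d + 1"
      by (simp add: h_def)
    with True \<open>\<not> j \<le> d + 1\<close> show False by simp
  qed
  show ?thesis
  proof (cases "c = 0")
    case False
    then have "0 \<in> set (d # r)" "0 < d" "0 < c"
      using u d j by auto
    then have "cluster_wt y (c # d # r) = 0" "cluster_wt y (d # r) = 0"
      using u by (auto intro!: cluster_wt_eq_0[of 0] simp del: cluster_wt.simps)
    with False show ?thesis
      unfolding eq by simp
  next
    case True
    then show ?thesis
      unfolding eq using d by (simp del: cluster_wt.simps)
  qed
qed

text \<open>
  Delete 0 and \<open>j\<close> and rename the other letters; the new second letter \<open>d\<close> runs
  over \<open>d \<ge> j - 1\<close>. For \<open>d \<ge> 2\<close> the remaining word starts with a match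
  itself. The value \<open>d = 1\<close>, possible only for \<open>j = 2\<close>, means that the chain of
  overlapping matches ends, and \<open>d\<close> starts an arbitrary cluster on the \<open>n - 3\<close>
  letters that remain.
\<close>

lemma cluster_sum2_rec:
  assumes "4 \<le> n" "2 \<le> j" "j < n"
  shows "cluster_sum2 y n j =
    - y * ((\<Sum>d\<in>{max 2 (j - 1)..<n - 2}. cluster_sum2 y (n - 2) d) +
           (if j = 2 then cluster_sum y (n - 3) else 0))"
proof -
  define h where "h = (\<lambda>i. if i + 1 < j then i + 1 else i + 2)"
  define X where "X = {..<n - 2}"
  define T where "T = (\<lambda>d. \<Sum>r\<in>permutations_of_set (X - {0, d}).
      cluster_wt y (0 # d # r) + y * cluster_wt y (d # r))"
  have sm: "strict_mono_on X h"
    by (auto intro!: strict_mono_onI simp: h_def)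
  have im: "h ` X = {..<n} - {0, j}"
  proof (intro equalityI subsetI)
    fix i assume i: "i \<in> {..<n} - {0, j}"
    then have "i = h (if i < j then i - 1 else i - 2)" "(if i < j then i - 1 else i - 2) \<in> X"
      using assms by (auto simp: h_def X_def)
    then show "i \<in> h ` X" by blast
  qed (use assms in \<open>auto simp: h_def X_def\<close>)
  have T1: "T 1 = cluster_sum y (n - 3)"
  proof -
    have "cluster_wt y (0 # 1 # r) + y * cluster_wt y (1 # r) = cluster_wt y (1 # r)" for r
      unfolding cluster_wt_0_1 by (simp add: algebra_simps)
    then have "T 1 = cluster_sum y (n - 2 - 1)"
      unfolding T_def X_def using assms by (simp only: cluster_sum_from_1)
    then show ?thesis by simp
  qed
  have T2: "T d = cluster_sum2 y (n - 2) d" if "2 \<le> d" for d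
  proof -
    have "cluster_wt y (d # r) = 0" if "r \<in> permutations_of_set (X - {0, d})" for r
      using that \<open>2 \<le> d\<close> assms
      by (intro cluster_wt_eq_0[of 1]) (auto simp: permutations_of_set_iff X_def)
    then show ?thesis
      by (simp add: T_def cluster_sum2_def X_def)
  qed
  have "cluster_sum2 y n j = (\<Sum>u\<in>permutations_of_set X. cluster_wt y (0 # j # map h u))"
    unfolding cluster_sum2_def im[symmetric] by (rule sum_words_map[OF sm])
  also have "\<dots> = (\<Sum>c\<in>X. \<Sum>v\<in>permutations_of_set (X - {c}). cluster_wt y (0 # j # map h (c # v)))"
  proof (rule sum_words_Cons)
    have "0 \<in> X" using assms by (simp add: X_def)
    then show "X \<noteq> {}" by blast
  qed (simp add: X_def)
  also have "\<dots> = (\<Sum>c\<in>X. \<Sum>d\<in>X - {c}. \<Sum>r\<in>permutations_of_set (X - {c} - {d}).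
      cluster_wt y (0 # j # map h (c # d # r)))"
  proof (intro sum.cong refl sum_words_Cons)
    fix c
    have "0 < n - 2" "1 < n - 2"
      using assms by linarith+
    then have "(if c = 0 then 1 else 0) \<in> X - {c}"
      by (simp add: X_def)
    then show "X - {c} \<noteq> {}" by blast
  qed (auto simp: X_def)
  also have "\<dots> = (\<Sum>c\<in>X. if c = 0 then \<Sum>d\<in>X - {0}. if j \<le> d + 1 then - y * T d else 0 else 0)"
  proof (rule sum.cong[OF refl])
    fix c assume "c \<in> X"
    have "(\<Sum>r\<in>permutations_of_set (X - {c} - {d}). cluster_wt y (0 # j # map h (c # d # r))) =
        (if c = 0 \<and> j \<le> d + 1 then - y * T d else 0)" if "d \<in> X - {c}" for d
    proof -
      have "0 \<in> set (c # d # r)" if "r \<in> permutations_of_set (X - {c} - {d})" for r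
        using that assms by (auto simp: permutations_of_set_iff X_def)
      then have "(\<Sum>r\<in>permutations_of_set (X - {c} - {d}). cluster_wt y (0 # j # map h (c # d # r))) =
         (\<Sum>r\<in>permutations_of_set (X - {c} - {d}). if c = 0 \<and> j \<le> d + 1
            then - y * (cluster_wt y (c # d # r) + y * cluster_wt y (d # r)) else 0)"
        unfolding h_def by (intro sum.cong refl cluster_wt_skip assms)
      then show ?thesis
        by (auto simp: T_def sum_distrib_left Diff_insert[symmetric] insert_commute
            intro!: sum.cong)
    qed
    then show "(\<Sum>d\<in>X - {c}. \<Sum>r\<in>permutations_of_set (X - {c} - {d}).
      cluster_wt y (0 # j # map h (c # d # r))) = (if c = 0 then \<Sum>d\<in>X - {0}. if j \<le> d + 1 then - y * T d else 0 else 0)"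
      by simp
  qed
  also have "\<dots> = (\<Sum>d\<in>X - {0}. if j \<le> d + 1 then - y * T d else 0)"
    using assms by (simp add: X_def)
  also have "\<dots> = - y * (\<Sum>d\<in>{d \<in> X - {0}. j \<le> d + 1}. T d)"
    unfolding sum_distrib_left by (rule sum.inter_filter[symmetric]) (simp add: X_def)
  also have "{d \<in> X - {0}. j \<le> d + 1} = (if j = 2 then {1} else {}) \<union> {max 2 (j - 1)..<n - 2}"
    using assms by (auto simp: X_def)
  also have "sum T \<dots> = (if j = 2 then T 1 else 0) + (\<Sum>d\<in>{max 2 (j - 1)..<n - 2}. T d)"
    by (subst sum.union_disjoint) auto
  also have "(\<Sum>d\<in>{max 2 (j - 1)..<n - 2}. T d) = (\<Sum>d\<in>{max 2 (j - 1)..<n - 2}. cluster_sum2 y (n - 2) d)"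
    by (intro sum.cong refl T2) auto
  finally show ?thesis
    by (simp add: T1[unfolded One_nat_def] add.commute)
qed

section \<open>Ballot numbers\<close>

text \<open>
  For \<open>k \<ge> 1\<close>, \<open>ballot k m\<close> is \<open>ballot k 0\<close>, the
  \<open>k\<close>-th Catalan number, minus the first \<open>m\<close> terms of the \<open>k\<close>-th
  row of the array defined by iterating \<open>cluster_sum2_rec\<close>: it is the sum of the entries from
  the \<open>m\<close>-th on, and consecutive differences are the entries themselves. In this form the
  inner sums of the recursion telescope. The closed form is that of the reflection principle.
\<close>

definition ballot :: "nat \<Rightarrow> nat \<Rightarrow> 'a::field_char_0" where
  "ballot k m = of_nat ((2 * k - m - 1) choose k) - of_nat ((2 * k - m - 1) choose (k + 1))"

lemma ballot_eq_0: "k \<ge> 1 \<Longrightarrow> m \<ge> k \<Longrightarrow> ballot k m = 0"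
  by (simp add: ballot_def binomial_eq_0)

lemma ballot_1: "ballot 1 m = of_bool (m = 0)"
  by (simp add: ballot_def)

text \<open>
  Pascal's rule, supplemented for \<open>m = 0\<close> by the symmetry of the binomial coefficients. There
  the truncated \<open>m - 1\<close> is intended: the new second letter then runs over its whole range.
\<close>

lemma ballot_rec:
  assumes "k \<ge> 1"
  shows "ballot (Suc k) m - ballot (Suc k) (Suc m) = (ballot k (m - 1) :: 'a::field_char_0)"
proof (cases "m \<le> 2 * k")
  case False
  with assms show ?thesis
    by (simp add: ballot_eq_0)
next
  case True
  define N where "N = 2 * k - m"
  have N: "2 * Suc k - m - 1 = Suc N" "2 * Suc k - Suc m - 1 = N"
    using True by (auto simp: N_def)
  have step: "ballot (Suc k) m - ballot (Suc k) (Suc m) =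
      (of_nat (N choose k) - of_nat (N choose (k + 1)) :: 'a)"
    unfolding ballot_def N by simp
  show ?thesis
  proof (cases "m = 0")
    case False
    then have "2 * k - (m - 1) - 1 = N"
      using True by (simp add: N_def)
    then show ?thesis
      unfolding step by (simp add: ballot_def)
  next
    case m: True
    obtain l where k: "k = Suc l"
      using assms by (cases k) auto
    have "(Suc (2 * l) choose l) = (Suc (2 * l) choose Suc l)"
      using binomial_symmetric[of l "Suc (2 * l)"] by simp
    then show ?thesis
      unfolding step by (simp add: ballot_def N_def m k)
  qed
qed

lemma ballot_0: "k \<ge> 1 \<Longrightarrow> ballot k 0 = (catalan k :: 'a::field_char_0)"
proof -
  assume "k \<ge> 1"
  then obtain l where k: "k = Suc l"
    by (cases k) auto
  have sym: "(Suc (2 * l) choose l) = (Suc (2 * l) choose Suc l)"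
    using binomial_symmetric[of l "Suc (2 * l)"] by simp
  define p q where "p = (of_nat (Suc (2 * l) choose Suc l) :: 'a)"
    and "q = (of_nat (Suc (2 * l) choose Suc (Suc l)) :: 'a)"
  have "Suc (Suc l) * (Suc (2 * l) choose Suc (Suc l)) = l * (Suc (2 * l) choose Suc l)"
    using binomial_absorb_comp[of "Suc (2 * l)" "Suc l"] binomial_absorption[of "Suc l" "Suc (2 * l)"]
    by (simp del: binomial_Suc_Suc mult_Suc)
  then have "of_nat (Suc (Suc l)) * q = of_nat l * p"
    unfolding p_def q_def of_nat_mult[symmetric] by (simp only:)
  moreover have "of_nat (Suc (Suc l)) \<noteq> (0 :: 'a)"
    by (rule of_nat_neq_0)
  ultimately have "p - q = 1 / of_nat (Suc (Suc l)) * (p + p)"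
    by (simp add: field_simps)
  moreover have "of_nat (2 * k choose k) = p + p"
    using sym by (simp add: k p_def)
  moreover have "ballot k 0 = p - q"
    by (simp add: ballot_def k p_def q_def)
  ultimately show ?thesis
    by (simp add: catalan_def k)
qed

section \<open>The recursion for the coefficients of \<open>U\<close>\<close>

text \<open>
  The summation index \<open>k\<close> is the number of overlapping matches in the chain at the start of
  the word. This chain uses the \<open>2 k + 1\<close> smallest letters before its last one, which is the
  first letter of the rest.
\<close>

lemma cluster_sum2_eq:
  assumes "2 \<le> j" "j < n"
  shows "cluster_sum2 y n j =
    (\<Sum>k\<in>{1..(n - 2) div 2}. (- y) ^ k * (ballot k (j - 2) - ballot k (j - 1)) * cluster_sum y (n - 2 * k - 1))"
  using assms
proof (induction n arbitrary: j rule: less_induct)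
  case (less n)
  let ?G = "cluster_sum y"
  show ?case
  proof (cases "n = 3")
    case True
    with less.prems have "j = 2" by simp
    have "{..<3} - {0, 2} = {1 :: nat}" by auto
    then show ?thesis
      by (simp add: True \<open>j = 2\<close> cluster_sum2_def)
  next
    case False
    with less.prems have n: "4 \<le> n" by simp
    define M where "M = (n - 4) div 2"
    have M: "(n - 2) div 2 = Suc M"
      using n by (simp add: M_def)
    have diff_n: "n - 2 - 2 = n - 4" "n - 2 - 2 * k - 1 = n - 2 * k - 3" for k
      by simp_all
    have "(\<Sum>d\<in>{max 2 (j - 1)..<n - 2}. cluster_sum2 y (n - 2) d) =
        (\<Sum>d\<in>{max 2 (j - 1)..<n - 2}. \<Sum>k\<in>{1..M}.
           (- y) ^ k * (ballot k (d - 2) - ballot k (d - 1)) * ?G (n - 2 * k - 3))"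
    proof (rule sum.cong[OF refl])
      fix d assume "d \<in> {max 2 (j - 1)..<n - 2}"
      then show "cluster_sum2 y (n - 2) d = (\<Sum>k\<in>{1..M}.
           (- y) ^ k * (ballot k (d - 2) - ballot k (d - 1)) * ?G (n - 2 * k - 3))"
        using n less.IH[of "n - 2" d, unfolded diff_n] by (simp only: M_def) simp
    qed
    also have "\<dots> = (\<Sum>k\<in>{1..M}. \<Sum>d\<in>{max 2 (j - 1)..<n - 2}.
           (- y) ^ k * (ballot k (d - 2) - ballot k (d - 1)) * ?G (n - 2 * k - 3))"
      by (rule sum.swap)
    also have "\<dots> = (\<Sum>k\<in>{1..M}.
           (- y) ^ k * (ballot (Suc k) (j - 2) - ballot (Suc k) (j - 1)) * ?G (n - 2 * k - 3))"
    proof (rule sum.cong[OF refl])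
      fix k assume k: "k \<in> {1..M}"
      have "(\<Sum>d\<in>{max 2 (j - 1)..<n - 2}. ballot k (d - 2) - ballot k (d - 1)) =
          (\<Sum>d\<in>{max 2 (j - 1)..<n - 2}. (\<lambda>d. - ballot k (d - 2)) (Suc d) - (\<lambda>d. - ballot k (d - 2)) d :: 'a)"
        by (intro sum.cong refl) auto
      \<comment> \<open>The bound \<open>2 k + 2 \<le> n - 2\<close> for the shorter word makes the upper end of the telescope vanish.\<close>
      also have "\<dots> = ballot k (max 2 (j - 1) - 2) - ballot k (n - 4)"
        using less.prems n by (subst sum_Suc_diff') auto
      also have "ballot k (n - 4) = (0 :: 'a)"
        using k by (intro ballot_eq_0) (auto simp: M_def)
      also have "max 2 (j - 1) - 2 = (j - 2) - 1"
        by (auto simp: max_def numeral_3_eq_3)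
      also have "ballot k (j - 2 - 1) = (ballot (Suc k) (j - 2) - ballot (Suc k) (Suc (j - 2)) :: 'a)"
        using k by (intro ballot_rec[symmetric]) auto
      also have "Suc (j - 2) = j - 1"
        using less.prems by simp
      finally show "(\<Sum>d\<in>{max 2 (j - 1)..<n - 2}.
           (- y) ^ k * (ballot k (d - 2) - ballot k (d - 1)) * ?G (n - 2 * k - 3)) =
           (- y) ^ k * (ballot (Suc k) (j - 2) - ballot (Suc k) (j - 1)) * ?G (n - 2 * k - 3)"
        by (simp flip: sum_distrib_left sum_distrib_right)
    qed
    finally have sum: "(\<Sum>d\<in>{max 2 (j - 1)..<n - 2}. cluster_sum2 y (n - 2) d) = \<dots>" .
    have first: "(\<Sum>k\<in>{1..Suc M}. \<phi> k) = \<phi> 1 + (\<Sum>k\<in>{1..M}. \<phi> (Suc k))" for \<phi> :: "nat \<Rightarrow> 'a"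
      by (simp add: sum.atLeast_Suc_atMost sum.atLeast_Suc_atMost_Suc_shift del: sum.cl_ivl_Suc)
    have "n - 2 * Suc k - 1 = n - 2 * k - 3" for k
      by simp
    then have "(\<Sum>k\<in>{1..Suc M}. (- y) ^ k * (ballot k (j - 2) - ballot k (j - 1)) * ?G (n - 2 * k - 1)) =
        - y * (ballot 1 (j - 2) - ballot 1 (j - 1)) * ?G (n - 3) +
        (\<Sum>k\<in>{1..M}. - y * ((- y) ^ k * (ballot (Suc k) (j - 2) - ballot (Suc k) (j - 1)) * ?G (n - 2 * k - 3)))"
      unfolding first by (simp only: power_Suc power_one_right mult.assoc mult_1_right) simp
    then show ?thesis
      unfolding cluster_sum2_rec[OF n less.prems] sum M
      using less.prems by (auto simp: ballot_1[simplified] algebra_simps sum_distrib_left sum_negf)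
  qed
qed

lemma cluster_sum_rec:
  assumes "n \<ge> 2"
  shows "cluster_sum y n = (1 - y) * cluster_sum y (n - 1) +
    (\<Sum>k = 2..n div 2. (- y) ^ (k - 1) * catalan (k - 1) * cluster_sum y (n - 2 * k + 1))"
proof -
  let ?G = "cluster_sum y"
  have "(\<Sum>j\<in>{2..<n}. cluster_sum2 y n j) =
      (\<Sum>j\<in>{2..<n}. \<Sum>k\<in>{1..(n - 2) div 2}. (- y) ^ k * (ballot k (j - 2) - ballot k (j - 1)) * ?G (n - 2 * k - 1))"
    by (intro sum.cong refl cluster_sum2_eq) auto
  also have "\<dots> = (\<Sum>k\<in>{1..(n - 2) div 2}. \<Sum>j\<in>{2..<n}. (- y) ^ k * (ballot k (j - 2) - ballot k (j - 1)) * ?G (n - 2 * k - 1))"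
    by (rule sum.swap)
  also have "\<dots> = (\<Sum>k\<in>{1..(n - 2) div 2}. (- y) ^ k * catalan k * ?G (n - 2 * k - 1))"
  proof (rule sum.cong[OF refl])
    fix k assume k: "k \<in> {1..(n - 2) div 2}"
    then have "k \<le> (n - 2) div 2" by simp
    then have "k \<le> n - 2" by linarith
    have "(\<Sum>j\<in>{2..<n}. ballot k (j - 2) - ballot k (j - 1)) =
        (\<Sum>j\<in>{2..<n}. (\<lambda>j. - ballot k (j - 2)) (Suc j) - (\<lambda>j. - ballot k (j - 2)) j :: 'a)"
      by (intro sum.cong refl) auto
    also have "\<dots> = ballot k 0 - ballot k (n - 2)"
      using assms by (subst sum_Suc_diff') auto
    also have "\<dots> = catalan k"
      using k \<open>k \<le> n - 2\<close> by (simp add: ballot_0 ballot_eq_0)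
    finally show "(\<Sum>j\<in>{2..<n}. (- y) ^ k * (ballot k (j - 2) - ballot k (j - 1)) * ?G (n - 2 * k - 1)) =
        (- y) ^ k * catalan k * ?G (n - 2 * k - 1)"
      by (simp flip: sum_distrib_left sum_distrib_right)
  qed
  also have "\<dots> = (\<Sum>k = 2..n div 2. (- y) ^ (k - 1) * catalan (k - 1) * ?G (n - 2 * k + 1))"
  proof (rule sum.reindex_bij_witness[where i = "\<lambda>k. k - 1" and j = Suc], goal_cases)
    case (5 k)
    then have "n - 2 * Suc k + 1 = n - 2 * k - 1"
      by (simp only: atLeastAtMost_iff) presburger
    then show ?case by (simp only: diff_Suc_1)
  qed auto
  finally show ?thesis
    using assms cluster_sum_eq_sum2[of n y] by simp
qed

lemma cluster_sum_eq_U1324_coeff: "cluster_sum y n = U1324_coeff y n"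
proof (induction n rule: less_induct)
  case (less n)
  consider "n = 0" | "n = 1" | "n \<ge> 2" by linarith
  then show ?case
  proof cases
    case 3
    then have "(\<Sum>k = 2..n div 2. (- y) ^ (k - 1) * catalan (k - 1) * cluster_sum y (n - 2 * k + 1)) =
        (\<Sum>k = 2..n div 2. (- y) ^ (k - 1) * catalan (k - 1) * U1324_coeff y (n - 2 * k + 1))"
      by (intro sum.cong refl arg_cong2[where f = "(*)"] less) auto
    with 3 show ?thesis
      by (simp add: cluster_sum_rec less)
  qed (simp_all add: cluster_sum_def lessThan_Suc)
qed

lemma egf_cluster: "egf (cluster_wt y) = U1324 y"
  by (rule fps_ext) (simp add: egf_def U1324_def flip: cluster_sum_eq_U1324_coeff cluster_sum_def)

section \<open>Left-to-right minima\<close>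

lemma LRmin_Nil [simp]: "LRmin [] = 0"
  by (simp add: LRmin_def)

text \<open>
  No letter after the smallest letter \<open>a\<close> is a left-to-right minimum.
\<close>

lemma LRmin_append_min:
  assumes "\<And>b. b \<in> set u \<union> set v \<Longrightarrow> a < b"
  shows "LRmin (u @ a # v) = Suc (LRmin u)"
proof -
  let ?w = "u @ a # v"
  have nth_v: "a < ?w ! j" if "length u < j" "j < length ?w" for j
  proof -
    have "?w ! j = v ! (j - length u - 1)" "j - length u - 1 < length v"
      using that by (auto simp: nth_append nth_Cons')
    then show ?thesis using assms by simp
  qed
  have nth_u: "?w ! j = u ! j" if "j < length u" for j
    using that by (simp add: nth_append)
  have nth_a: "?w ! length u = a" by simp
  have "{j. j < length ?w \<and> (\<forall>i<j. ?w ! j < ?w ! i)} =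
        insert (length u) {j. j < length u \<and> (\<forall>i<j. u ! j < u ! i)}"
    (is "?L = insert _ ?R")
  proof (intro equalityI subsetI)
    fix j assume "j \<in> ?L"
    then have j: "j < length ?w" "\<And>i. i < j \<Longrightarrow> ?w ! j < ?w ! i" by auto
    then have "\<not> length u < j"
      using nth_v[of j] j(2)[of "length u"] by (auto simp del: length_append)
    with j show "j \<in> insert (length u) ?R"
      by (auto simp: nth_append split: if_splits)
  next
    fix j assume j: "j \<in> insert (length u) ?R"
    show "j \<in> ?L"
    proof (cases "j = length u")
      case True
      then show ?thesis
        using assms by (auto simp: nth_append)
    next
      case False
      then show ?thesis
        using j by (auto simp: nth_append)
    qed
  qed
  then show ?thesis
    by (simp add: LRmin_def)
qed

lemma LRmin_map:
  assumes "strict_mono_on (set w) h"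
  shows "LRmin (map h w) = LRmin w"
proof -
  have "h (w ! j) < h (w ! i) \<longleftrightarrow> w ! j < w ! i" if "j < length w" "i < j" for i j
    using that by (intro strict_mono_on_less[OF assms]) auto
  then show ?thesis
    unfolding LRmin_def by (intro arg_cong[where f = card]) auto
qed

text \<open>
  At \<open>x = 1\<close> this is \<open>avoid_wt\<close>, whose generating function is known to be the
  reciprocal of that of the clusters.
\<close>

definition lr_wt :: "'a::field_char_0 \<Rightarrow> 'a \<Rightarrow> nat list \<Rightarrow> 'a" where
  "lr_wt x y w = x ^ LRmin w * avoid_wt y w"

lemma order_invariant_lr_wt: "order_invariant (lr_wt x y)"
  using order_invariantD[OF order_invariant_avoid_wt[of y]]
  by (simp add: order_invariant_def lr_wt_def LRmin_map)

lemma bij_betw_one_line: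
  "bij_betw (one_line n) {\<sigma>. \<sigma> permutes {1..n}} (permutations_of_set {1..n})"
proof -
  let ?P = "{\<sigma>. \<sigma> permutes {1..n}}" and ?W = "permutations_of_set {1..n}"
  have "inj_on (one_line n) ?P"
  proof (rule inj_onI)
    fix \<sigma> \<tau> assume "\<sigma> \<in> ?P" "\<tau> \<in> ?P" and eq: "one_line n \<sigma> = one_line n \<tau>"
    then have p: "\<sigma> permutes {1..n}" "\<tau> permutes {1..n}" by auto
    show "\<sigma> = \<tau>"
    proof
      fix i show "\<sigma> i = \<tau> i"
    proof (cases "i \<in> {1..n}")
      case True
      then have "i \<in> set [1..<Suc n]" by auto
      then show ?thesis
        using eq unfolding one_line_def map_eq_conv by blast
    next
      case False
      then show ?thesis
        using p by (simp add: permutes_not_in)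
    qed
    qed
  qed
  moreover have "one_line n ` ?P \<subseteq> ?W"
  proof safe
    fix \<sigma> assume p: "\<sigma> permutes {1..n}"
    have "set [1..<Suc n] = {1..n}" by auto
    then show "one_line n \<sigma> \<in> ?W"
      using permutes_image[OF p] permutes_inj_on[OF p, of "{1..n}"]
      by (simp only: permutations_of_set_iff one_line_def distinct_map set_map distinct_upt simp_thms)
  qed
  moreover have "card ?P = card ?W"
    by (simp add: card_permutations)
  moreover have "finite ?W" by simp
  ultimately show ?thesis
    by (metis bij_betw_def card_image card_subset_eq)
qed

lemma NM_eq_egf: "NM [1, 3, 2, 4] x y = egf (lr_wt x y)"
proof (rule fps_ext)
  fix n
  show "NM [1, 3, 2, 4] x y $ n = egf (lr_wt x y) $ n"
  proof (cases "n = 0")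
    case True
    then show ?thesis
      by (simp add: NM_def egf_def lr_wt_def)
  next
    case False
    let ?w = "one_line n"
    have ne: "?w \<sigma> \<noteq> []" for \<sigma>
      using False by (simp add: one_line_def)
    have "(\<Sum>\<sigma>\<in>NM_set [1, 3, 2, 4] n. x ^ LRmin (?w \<sigma>) * y ^ (1 + des (?w \<sigma>))) =
          (\<Sum>\<sigma>\<in>NM_set [1, 3, 2, 4] n. lr_wt x y (?w \<sigma>))"
      by (intro sum.cong refl) (simp add: lr_wt_def avoid_wt_eq ne NM_set_def has_1324_def)
    also have "\<dots> = (\<Sum>\<sigma> | \<sigma> permutes {1..n}. lr_wt x y (?w \<sigma>))"
      by (rule sum.mono_neutral_left)
        (auto simp: finite_permutations NM_set_def lr_wt_def avoid_wt_eq ne has_1324_def)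
    also have "\<dots> = (\<Sum>w\<in>permutations_of_set {1..n}. lr_wt x y w)"
      by (rule sum.reindex_bij_betw[OF bij_betw_one_line])
    also have "\<dots> = (\<Sum>w\<in>permutations_of_set {..<n}. lr_wt x y w)"
      using sum_words_card[OF order_invariant_lr_wt, of "{1..n}" x y] by simp
    finally show ?thesis
      using False by (simp add: NM_def egf_def)
  qed
qed

section \<open>The differential equation\<close>

lemma sum_lr_wt_rec:
  assumes "finite A" "a \<in> A" "\<And>b. b \<in> A \<Longrightarrow> a \<le> b"
  shows "(\<Sum>w\<in>permutations_of_set A. lr_wt x y w) =
    (\<Sum>B\<in>Pow (A - {a}). (\<Sum>u\<in>permutations_of_set B. lr_wt x y u) *
       (\<Sum>v\<in>permutations_of_set (A - {a} - B). x * avoid_wt y (a # v)))"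
proof -
  have "lr_wt x y (u @ a # v) = lr_wt x y u * (x * avoid_wt y (a # v))"
    if "u \<in> permutations_of_set B" "v \<in> permutations_of_set (A - {a} - B)" "B \<in> Pow (A - {a})" for u v B
  proof -
    have less: "a < b" if "b \<in> set u \<union> set v" for b
    proof -
      have "b \<in> A" "b \<noteq> a"
        using that \<open>u \<in> _\<close> \<open>v \<in> _\<close> \<open>B \<in> _\<close> by (auto simp: permutations_of_set_iff)
      then show ?thesis
        using assms(3)[of b] by simp
    qed
    have "LRmin (u @ a # v) = Suc (LRmin u)"
      by (intro LRmin_append_min less)
    moreover have "avoid_wt y (u @ a # v) = avoid_wt y u * avoid_wt y (a # v)"
      by (intro avoid_wt_append_min less) simp
    ultimately show ?thesis
      by (simp add: lr_wt_def)
  qed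
  then show ?thesis
    unfolding sum_words_around[OF assms(1,2)] sum_product
    by (intro sum.cong refl) auto
qed

text \<open>
  The weight of \<open>v\<close> with a letter smaller than all others put in front; the shift makes room
  for 0.
\<close>

definition min_wt :: "'a::field_char_0 \<Rightarrow> nat list \<Rightarrow> 'a" where
  "min_wt y v = avoid_wt y (0 # map Suc v)"

lemma avoid_wt_Cons_min:
  assumes "\<And>b. b \<in> set v \<Longrightarrow> a < b"
  shows "avoid_wt y (a # v) = min_wt y v"
proof -
  let ?h = "\<lambda>b. if b = a then 0 else Suc b"
  have "a \<notin> set v"
    using assms by blast
  then have "strict_mono_on (set (a # v)) ?h"
    using assms by (auto intro!: strict_mono_onI dest: order.asym)
  then have "avoid_wt y (map ?h (a # v)) = avoid_wt y (a # v)"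
    by (rule order_invariantD[OF order_invariant_avoid_wt])
  moreover have "map ?h (a # v) = 0 # map Suc v"
    using assms by auto
  then have "avoid_wt y (map ?h (a # v)) = avoid_wt y (0 # map Suc v)"
    by (rule arg_cong)
  ultimately show ?thesis
    unfolding min_wt_def by simp
qed

lemma order_invariant_min_wt: "order_invariant (min_wt y)"
  unfolding order_invariant_def
proof (intro allI impI)
  fix h :: "nat \<Rightarrow> nat" and v assume h: "strict_mono_on (set v) h"
  let ?h = "case_nat 0 (\<lambda>b. Suc (h b))"
  have "strict_mono_on (set (0 # map Suc v)) ?h"
    using h by (auto intro!: strict_mono_onI simp: strict_mono_on_def split: nat.splits)
  then have "avoid_wt y (map ?h (0 # map Suc v)) = avoid_wt y (0 # map Suc v)"
    by (rule order_invariantD[OF order_invariant_avoid_wt])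
  moreover have "map ?h (0 # map Suc v) = 0 # map Suc (map h v)"
    by simp
  ultimately show "min_wt y (map h v) = min_wt y v"
    by (simp only: min_wt_def)
qed

text \<open>
  The coefficient form of this equation is \<open>sum_lr_wt_rec\<close> for \<open>A = {0, \<dots>,
  n}\<close>: the smallest letter is fixed, and the other \<open>n\<close> letters are distributed to its
  left and to its right.
\<close>

lemma fps_deriv_egf_lr_wt:
  "fps_deriv (egf (lr_wt x y)) = fps_const x * egf (min_wt y) * egf (lr_wt x y)"
proof (rule fps_ext)
  fix n
  have card: "card ({..<Suc n} - {0}) = n" by simp
  have "fact (Suc n) * egf (lr_wt x y) $ Suc n = (\<Sum>w\<in>permutations_of_set {..<Suc n}. lr_wt x y w)"
    by (simp add: egf_def del: fact_Suc)
  also have "\<dots> = (\<Sum>B\<in>Pow ({..<Suc n} - {0}). (\<Sum>u\<in>permutations_of_set B. lr_wt x y u) *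
       (\<Sum>v\<in>permutations_of_set ({..<Suc n} - {0} - B). x * avoid_wt y (0 # v)))"
    by (rule sum_lr_wt_rec) auto
  also have "\<dots> = (\<Sum>B\<in>Pow ({..<Suc n} - {0}). x * ((\<Sum>u\<in>permutations_of_set B. lr_wt x y u) *
       (\<Sum>v\<in>permutations_of_set ({..<Suc n} - {0} - B). min_wt y v)))"
  proof (rule sum.cong[OF refl])
    fix B
    have "(\<Sum>v\<in>permutations_of_set ({..<Suc n} - {0} - B). x * avoid_wt y (0 # v)) =
        x * (\<Sum>v\<in>permutations_of_set ({..<Suc n} - {0} - B). min_wt y v)"
      unfolding sum_distrib_left
      by (intro sum.cong refl arg_cong2[where f = "(*)"] avoid_wt_Cons_min)
        (auto simp: permutations_of_set_iff)
    then show "(\<Sum>u\<in>permutations_of_set B. lr_wt x y u) *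
       (\<Sum>v\<in>permutations_of_set ({..<Suc n} - {0} - B). x * avoid_wt y (0 # v)) =
       x * ((\<Sum>u\<in>permutations_of_set B. lr_wt x y u) *
       (\<Sum>v\<in>permutations_of_set ({..<Suc n} - {0} - B). min_wt y v))"
      by (simp add: mult.left_commute)
  qed
  also have "\<dots> = x * (fact n * (egf (lr_wt x y) * egf (min_wt y)) $ n)"
    using sum_words_egf_mult[OF order_invariant_lr_wt order_invariant_min_wt, of "{..<Suc n} - {0}" x y y]
    unfolding sum_distrib_left[symmetric] card by simp
  finally have "fact n * (of_nat (Suc n) * egf (lr_wt x y) $ Suc n) =
      fact n * (x * (egf (lr_wt x y) * egf (min_wt y)) $ n)"
    by (simp add: mult_ac del: of_nat_Suc)
  then have "of_nat (Suc n) * egf (lr_wt x y) $ Suc n = x * (egf (lr_wt x y) * egf (min_wt y)) $ n"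
    by simp
  then show "fps_deriv (egf (lr_wt x y)) $ n = (fps_const x * egf (min_wt y) * egf (lr_wt x y)) $ n"
    by (simp add: mult_ac)
qed

lemma fps_linear_ode_unique:
  fixes F G K :: "'a::field_char_0 fps"
  assumes "fps_deriv F = K * F" "fps_deriv G = K * G" "F $ 0 = G $ 0"
  shows "F = G"
proof (rule fps_ext)
  fix n show "F $ n = G $ n"
  proof (induction n rule: less_induct)
    case (less n)
    show ?case
    proof (cases n)
      case 0
      then show ?thesis using assms(3) by simp
    next
      case (Suc m)
      have "of_nat (Suc m) * F $ Suc m = (\<Sum>i=0..m. K $ i * F $ (m - i))"
        using arg_cong[OF assms(1), of "\<lambda>H. H $ m"] by (simp add: fps_mult_nth)
      also have "\<dots> = (\<Sum>i=0..m. K $ i * G $ (m - i))"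
        using Suc by (intro sum.cong refl) (simp add: less)
      also have "\<dots> = of_nat (Suc m) * G $ Suc m"
        using arg_cong[OF assms(2), of "\<lambda>H. H $ m"] by (simp add: fps_mult_nth)
      finally show ?thesis
        using Suc by (simp del: of_nat_Suc)
    qed
  qed
qed

lemma fps_deriv_fps_log:
  assumes "U $ 0 = 1"
  shows "fps_deriv (fps_log U) = inverse U * fps_deriv U"
proof -
  have "inverse (1 + fps_X) oo (U - 1) = inverse ((1 + fps_X) oo (U - 1))"
    using assms by (intro fps_inverse_compose) auto
  also have "(1 + fps_X) oo (U - 1) = U"
    using assms by (simp add: fps_compose_add_distrib)
  finally show ?thesis
    using assms by (simp add: fps_log_def fps_compose_deriv fps_ln_deriv)
qed

text \<open>
  Differentiating \<open>N U = 1\<close> at \<open>x = 1\<close> yields \<open>(log U)' = U' / U = -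
  K\<close>. So \<open>exp (- x log U)\<close> has the logarithmic derivative \<open>x K\<close>, for
  every \<open>x\<close>.
\<close>

lemma egf_lr_wt_eq_recip_power: "egf (lr_wt x y) = fps_recip_power (U1324 y) x"
proof (rule fps_linear_ode_unique)
  let ?U = "U1324 y" and ?K = "egf (min_wt y)" and ?N = "egf (avoid_wt y)"
  have U0: "?U $ 0 = 1"
    by (simp add: U1324_def)
  have NU: "?N * ?U = 1"
    using egf_avoid_cluster[of y] by (simp add: egf_cluster)
  have "lr_wt 1 y = avoid_wt y"
    by (simp add: lr_wt_def fun_eq_iff)
  then have N': "fps_deriv ?N = ?K * ?N"
    using fps_deriv_egf_lr_wt[of 1 y] by simp
  have "?N * fps_deriv ?U + fps_deriv ?N * ?U = 0"
    using arg_cong[OF NU, of fps_deriv] by simp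
  then have "?N * fps_deriv ?U = - ?K"
    by (simp add: N' mult.assoc NU eq_neg_iff_add_eq_0)
  moreover have "inverse ?U = ?N"
    using NU U0 by (intro fps_inverse_unique) (simp add: mult.commute)
  ultimately have L': "fps_deriv (fps_log ?U) = - ?K"
    by (simp add: fps_deriv_fps_log[OF U0])
  have L0: "fps_log ?U $ 0 = 0"
    by (simp add: fps_log_def)
  show "fps_deriv (egf (lr_wt x y)) = (fps_const x * ?K) * egf (lr_wt x y)"
    by (rule fps_deriv_egf_lr_wt)
  show "fps_deriv (fps_recip_power ?U x) = (fps_const x * ?K) * fps_recip_power ?U x"
    by (simp add: fps_recip_power_def fps_compose_deriv L0 L' mult_ac del: fps_const_neg)
  show "egf (lr_wt x y) $ 0 = fps_recip_power ?U x $ 0"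
    by (simp add: egf_def lr_wt_def fps_recip_power_def)
qed

section \<open>Removing the cycle of the smallest element\<close>

definition cycles_on :: "nat set \<Rightarrow> (nat \<Rightarrow> nat) \<Rightarrow> nat list set" where
  "cycles_on A \<sigma> = {support \<sigma> c |c. c \<in> A \<and> (\<forall>d\<in>set (support \<sigma> c). c \<le> d)}"

lemma finite_cycles_on: "finite A \<Longrightarrow> finite (cycles_on A \<sigma>)"
  by (simp add: cycles_on_def)

lemma permutation_if_permutes: "finite A \<Longrightarrow> \<sigma> permutes A \<Longrightarrow> permutation \<sigma>"
  using permutation_permutes by blast

lemma support_Cons:
  assumes "permutation \<sigma>"
  shows "\<exists>v. support \<sigma> c = c # v"
proof -
  obtain l where "least_power \<sigma> c = Suc l"
    using least_power_of_permutation(2)[OF assms, of c] by (cases "least_power \<sigma> c") auto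
  then show ?thesis
    by (simp add: upt_conv_Cons del: upt_Suc)
qed

lemma set_support_subset:
  assumes "\<sigma> permutes A" "c \<in> A"
  shows "set (support \<sigma> c) \<subseteq> A"
  using assms permutes_in_image[OF permutes_funpow[OF assms(1)]] by auto

lemma cycle_of_list_nth:
  assumes "distinct C" "i < length C"
  shows "cycle_of_list C (C ! i) = C ! (Suc i mod length C)"
proof -
  have "map (cycle_of_list C) C = rotate1 C"
    using cyclic_rotation[OF assms(1), of 1] by simp
  then have "cycle_of_list C (C ! i) = rotate1 C ! i"
    using assms(2) by (metis nth_map)
  also have "\<dots> = C ! (Suc i mod length C)"
    using assms(2) by (simp add: nth_rotate1)
  finally show ?thesis .
qed

text \<open>
  The permutation \<open>\<sigma>\<close> of \<open>A\<close> is composed of a permutation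
  \<open>\<tau>\<close> of \<open>B\<close> and the cycle \<open>a v\<close> on the rest of
  \<open>A\<close>, which contains the minimum \<open>a\<close>. The facts below say that
  \<open>\<sigma>\<close> determines \<open>B\<close>, \<open>v\<close> and \<open>\<tau>\<close>, and
  that its cycles are those of \<open>\<tau>\<close> together with \<open>a v\<close>.
\<close>

locale attached_cycle =
  fixes A B :: "nat set" and a :: nat and v :: "nat list" and \<tau> \<sigma> :: "nat \<Rightarrow> nat"
  assumes finite: "finite A"
    and min: "\<And>b. b \<in> A \<Longrightarrow> a \<le> b"
    and permutes: "\<tau> permutes B"
    and union: "A = B \<union> set (a # v)"
    and disjoint: "B \<inter> set (a # v) = {}"
    and distinct: "distinct (a # v)"
    and \<sigma>_def: "\<sigma> = \<tau> \<circ> cycle_of_list (a # v)"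
begin

lemma on_cycle: "b \<in> set (a # v) \<Longrightarrow> \<sigma> b = cycle_of_list (a # v) b"
proof -
  assume "b \<in> set (a # v)"
  then have "cycle_of_list (a # v) b \<in> set (a # v)"
    using cycle_is_surj[OF distinct] by blast
  then have "cycle_of_list (a # v) b \<notin> B"
    using disjoint by blast
  then show ?thesis
    unfolding \<sigma>_def o_apply by (rule permutes_not_in[OF permutes])
qed

lemma off_cycle: "b \<in> B \<Longrightarrow> \<sigma> b = \<tau> b"
proof -
  assume "b \<in> B"
  then have "b \<notin> set (a # v)"
    using disjoint by blast
  then have "cycle_of_list (a # v) b = b"
    by (rule id_outside_supp)
  then show ?thesis
    by (simp only: \<sigma>_def o_apply)
qed

lemma permutes_A: "\<sigma> permutes A"
  unfolding \<sigma>_def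
  by (rule permutes_compose[OF permutes_subset[OF cycle_permutes] permutes_subset[OF permutes]])
    (use union in auto)

lemma permutation: "permutation \<sigma>"
  using permutes_A finite by (rule permutation_if_permutes[rotated])

lemma funpow_min:
  assumes "i \<le> length v"
  shows "(\<sigma> ^^ i) a = (a # v) ! i"
  using assms
proof (induction i)
  case (Suc i)
  then have "(\<sigma> ^^ Suc i) a = \<sigma> ((a # v) ! i)"
    by simp
  also have "\<dots> = cycle_of_list (a # v) ((a # v) ! i)"
    by (rule on_cycle) (rule nth_mem, use Suc in simp)
  also have "\<dots> = (a # v) ! Suc i"
    using cycle_of_list_nth[OF distinct, of i] Suc by (simp del: cycle_of_list.simps)
  finally show ?case .
qed simp

lemma support_min: "support \<sigma> a = a # v"
proof -
  let ?l = "Suc (length v)"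
  have "(\<sigma> ^^ ?l) a = \<sigma> ((a # v) ! length v)"
    by (simp only: funpow.simps o_apply funpow_min[OF order_refl])
  also have "\<dots> = cycle_of_list (a # v) ((a # v) ! length v)"
    by (rule on_cycle) (rule nth_mem, simp)
  also have "\<dots> = a"
    using cycle_of_list_nth[OF distinct, of "length v"] by (simp del: cycle_of_list.simps)
  finally have "(\<sigma> ^^ ?l) a = a" .
  moreover have "(\<sigma> ^^ i) a \<noteq> a" if "0 < i" "i < ?l" for i
    using funpow_min[of i] that nth_eq_iff_index_eq[OF distinct, of i 0] by simp
  ultimately have "least_power \<sigma> a = ?l"
    unfolding least_power_def by (intro Least_equality) (auto simp: not_less[symmetric])
  then show ?thesis
    using funpow_min by (intro nth_equalityI) (auto simp del: upt_Suc)
qed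

lemma support_off_cycle:
  assumes "b \<in> B"
  shows "support \<sigma> b = support \<tau> b"
proof -
  have "(\<sigma> ^^ i) b = (\<tau> ^^ i) b" for i
  proof (induction i)
    case (Suc i)
    have "(\<tau> ^^ i) b \<in> B"
      using assms permutes_in_image[OF permutes_funpow[OF permutes]] by blast
    then show ?case
      using Suc off_cycle by simp
  qed simp
  then show ?thesis
    by (simp add: least_power_def)
qed

lemma cycles_on_A: "cycles_on A \<sigma> = insert (a # v) (cycles_on B \<tau>)"
proof -
  \<comment> \<open>The cycle of \<open>c\<close> is that of \<open>a\<close>, so its smallest element is \<open>a\<close>.\<close>
  have eq_a: "c = a" if "c \<in> set (a # v)" "\<forall>d\<in>set (support \<sigma> c). c \<le> d" for c
  proof -
    have "c \<in> set (support \<sigma> c)"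
      using support_Cons[OF permutation, of c] by (metis list.set_intros(1))
    then have "a \<in> set (support \<sigma> c)"
      using disjoint_support'[OF permutation, of a c] that(1) support_min by auto
    moreover have "a \<le> c"
      using min that(1) union by auto
    ultimately show ?thesis
      using that(2) by (blast intro: antisym)
  qed
  have a_le: "\<forall>d\<in>set (a # v). a \<le> d"
    using min unfolding union by blast
  show ?thesis
  proof (intro equalityI subsetI)
    fix C assume "C \<in> cycles_on A \<sigma>"
    then obtain c where c: "C = support \<sigma> c" "c \<in> A" "\<forall>d\<in>set (support \<sigma> c). c \<le> d"
      unfolding cycles_on_def by blast
    show "C \<in> insert (a # v) (cycles_on B \<tau>)"
    proof (cases "c \<in> B")
      case True
      then show ?thesis
        using c(1,3) unfolding support_off_cycle[OF True] cycles_on_def by blast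
    next
      case False
      then have "c = a"
        using c(2) eq_a[OF _ c(3)] unfolding union by blast
      then show ?thesis
        using c(1) support_min by simp
    qed
  next
    fix C assume "C \<in> insert (a # v) (cycles_on B \<tau>)"
    then consider "C = support \<sigma> a" | c where "C = support \<sigma> c" "c \<in> B" "\<forall>d\<in>set (support \<sigma> c). c \<le> d"
      using support_min support_off_cycle unfolding cycles_on_def by auto
    then show "C \<in> cycles_on A \<sigma>"
    proof cases
      case 1
      moreover have "a \<in> A"
        unfolding union by simp
      ultimately show ?thesis
        using a_le unfolding cycles_on_def support_min[symmetric] by blast
    next
      case (2 c)
      then have "c \<in> A"
        unfolding union by blast
      with 2 show ?thesis
        unfolding cycles_on_def by blast
    qed
  qed
qed

lemma new_cycle: "a # v \<notin> cycles_on B \<tau>"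
proof
  assume "a # v \<in> cycles_on B \<tau>"
  then have "\<exists>c. a # v = support \<tau> c \<and> c \<in> B"
    unfolding cycles_on_def mem_Collect_eq by (elim exE conjE) (intro exI conjI)
  then obtain c where "a # v = support \<tau> c" "c \<in> B"
    by (elim exE conjE)
  then have "set (a # v) \<subseteq> B"
    using set_support_subset[OF permutes] by metis
  then show False
    using disjoint by auto
qed

lemma detach: "A - set (support \<sigma> a) = B" "tl (support \<sigma> a) = v" "(\<lambda>b. if b \<in> B then \<sigma> b else b) = \<tau>"
proof -
  show "A - set (support \<sigma> a) = B"
    using union disjoint by (auto simp: support_min simp del: set_map)
  show "tl (support \<sigma> a) = v"
    by (simp only: support_min list.sel)
  show "(\<lambda>b. if b \<in> B then \<sigma> b else b) = \<tau>"
    using off_cycle permutes permutes_not_in by fastforce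
qed

end

lemma attached_cycle_detach:
  assumes "finite A" "a \<in> A" "\<And>b. b \<in> A \<Longrightarrow> a \<le> b" "\<sigma> permutes A"
  defines "B \<equiv> A - set (support \<sigma> a)"
  shows "attached_cycle A B a (tl (support \<sigma> a)) (\<lambda>b. if b \<in> B then \<sigma> b else b) \<sigma>"
proof -
  let ?C = "support \<sigma> a"
  have p: "permutation \<sigma>"
    using assms by (blast intro: permutation_if_permutes)
  have C: "a # tl ?C = ?C"
    using support_Cons[OF p, of a] by (metis list.sel(3))
  have CA: "set ?C \<subseteq> A"
    using assms by (intro set_support_subset)
  have distinct: "distinct ?C"
    by (rule cycle_of_permutation[OF p])
  have on: "cycle_of_list ?C b = \<sigma> b" if "b \<in> set ?C" for b
    using cycle_restrict[OF p that] by simp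
  then have surj: "\<sigma> ` set ?C = set ?C"
    using cycle_is_surj[OF distinct] by (metis image_cong)
  have "(\<lambda>b. if b \<in> B then \<sigma> b else b) permutes B"
    unfolding B_def by (rule semidecomposition[OF assms(4,1)])
  moreover have "\<sigma> = (\<lambda>b. if b \<in> B then \<sigma> b else b) \<circ> cycle_of_list ?C"
  proof
    fix b
    consider "b \<in> set ?C" | "b \<in> B" "b \<notin> set ?C" | "b \<notin> A" "b \<notin> set ?C"
      using CA unfolding B_def by blast
    then show "\<sigma> b = ((\<lambda>b. if b \<in> B then \<sigma> b else b) \<circ> cycle_of_list ?C) b"
    proof cases
      case 1
      then have "\<sigma> b \<notin> B"
        using surj unfolding B_def by blast
      then show ?thesis
        using on[OF 1] by simp
    next
      case 2
      then show ?thesis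
        using id_outside_supp[OF 2(2)] by simp
    next
      case 3
      then show ?thesis
        using id_outside_supp[OF 3(2)] permutes_not_in[OF assms(4)] by simp
    qed
  qed
  ultimately show ?thesis
    unfolding attached_cycle_def C using assms(1,3) CA distinct
    by (auto simp: B_def simp del: set_map)
qed

text \<open>
  Detaching the cycle of the smallest element is a bijection from the permutations of \<open>A\<close> to
  the triples of a subset \<open>B\<close> without \<open>a\<close>, a permutation of \<open>B\<close>,
  and an order of the remaining elements.
\<close>

lemma sum_cycles_rec:
  fixes \<phi> :: "nat list \<Rightarrow> 'a::comm_semiring_1"
  assumes "finite A" "a \<in> A" "\<And>b. b \<in> A \<Longrightarrow> a \<le> b"
  shows "(\<Sum>\<sigma> | \<sigma> permutes A. \<Prod>C\<in>cycles_on A \<sigma>. \<phi> C) =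
    (\<Sum>B\<in>Pow (A - {a}). (\<Sum>\<tau> | \<tau> permutes B. \<Prod>C\<in>cycles_on B \<tau>. \<phi> C) *
       (\<Sum>v\<in>permutations_of_set (A - {a} - B). \<phi> (a # v)))"
proof -
  let ?S = "Sigma (Pow (A - {a})) (\<lambda>B. {\<tau>. \<tau> permutes B} \<times> permutations_of_set (A - {a} - B))"
  have finite_sub: "finite B" if "B \<in> Pow (A - {a})" for B
    using that assms(1) by (auto intro: finite_subset)
  have attached: "attached_cycle A B a v \<tau> (\<tau> \<circ> cycle_of_list (a # v))"
    if "(B, \<tau>, v) \<in> ?S" for B \<tau> v
    using that assms unfolding attached_cycle_def by (auto simp: permutations_of_set_iff)
  have "(\<Sum>\<sigma> | \<sigma> permutes A. \<Prod>C\<in>cycles_on A \<sigma>. \<phi> C) =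
        (\<Sum>(B, \<tau>, v)\<in>?S. (\<Prod>C\<in>cycles_on B \<tau>. \<phi> C) * \<phi> (a # v))"
  proof (rule sum.reindex_bij_witness[symmetric, where
        j = "\<lambda>(B, \<tau>, v). \<tau> \<circ> cycle_of_list (a # v)" and
        i = "\<lambda>\<sigma>. let B = A - set (support \<sigma> a) in (B, \<lambda>b. if b \<in> B then \<sigma> b else b, tl (support \<sigma> a))"],
        goal_cases)
    case (1 p)
    then obtain B \<tau> v where p: "p = (B, \<tau>, v)" and S: "(B, \<tau>, v) \<in> ?S" by (cases p) auto
    interpret attached_cycle A B a v \<tau> "\<tau> \<circ> cycle_of_list (a # v)"
      by (rule attached[OF S])
    show ?case
      unfolding p prod.case Let_def detach ..
  next
    case (2 p)
    then obtain B \<tau> v where p: "p = (B, \<tau>, v)" and S: "(B, \<tau>, v) \<in> ?S" by (cases p) auto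
    interpret attached_cycle A B a v \<tau> "\<tau> \<circ> cycle_of_list (a # v)"
      by (rule attached[OF S])
    show ?case
      unfolding p prod.case using permutes_A by blast
  next
    case (3 \<sigma>)
    then interpret attached_cycle A "A - set (support \<sigma> a)" a "tl (support \<sigma> a)"
        "\<lambda>b. if b \<in> A - set (support \<sigma> a) then \<sigma> b else b" \<sigma>
      using assms by (intro attached_cycle_detach) auto
    show ?case
      unfolding Let_def prod.case by (rule \<sigma>_def[symmetric])
  next
    case (4 \<sigma>)
    then interpret attached_cycle A "A - set (support \<sigma> a)" a "tl (support \<sigma> a)"
        "\<lambda>b. if b \<in> A - set (support \<sigma> a) then \<sigma> b else b" \<sigma>
      using assms by (intro attached_cycle_detach) auto
    have "A - set (support \<sigma> a) \<in> Pow (A - {a})"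
      using disjoint by auto
    moreover have "tl (support \<sigma> a) \<in> permutations_of_set (A - {a} - (A - set (support \<sigma> a)))"
      unfolding permutations_of_set_iff using union disjoint distinct by auto
    ultimately show ?case
      unfolding Let_def using permutes by simp
  next
    case (5 p)
    then obtain B \<tau> v where p: "p = (B, \<tau>, v)" and S: "(B, \<tau>, v) \<in> ?S" by (cases p) auto
    interpret attached_cycle A B a v \<tau> "\<tau> \<circ> cycle_of_list (a # v)"
      by (rule attached[OF S])
    have "finite B"
      using S finite_sub by blast
    then show ?case
      unfolding p prod.case cycles_on_A
      using new_cycle by (simp add: finite_cycles_on mult.commute del: cycle_of_list.simps)
  qed
  also have "\<dots> = (\<Sum>B\<in>Pow (A - {a}). \<Sum>(\<tau>, v)\<in>{\<tau>. \<tau> permutes B} \<times> permutations_of_set (A - {a} - B).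
       (\<Prod>C\<in>cycles_on B \<tau>. \<phi> C) * \<phi> (a # v))"
    using assms(1) finite_sub by (subst sum.Sigma) (auto simp: finite_permutations)
  also have "\<dots> = (\<Sum>B\<in>Pow (A - {a}). (\<Sum>\<tau> | \<tau> permutes B. \<Prod>C\<in>cycles_on B \<tau>. \<phi> C) *
       (\<Sum>v\<in>permutations_of_set (A - {a} - B). \<phi> (a # v)))"
    by (simp add: sum_product sum.cartesian_product)
  finally show ?thesis .
qed

text \<open>
  With \<open>\<phi> C = x * avoid_wt y C\<close> the recursion \<open>sum_cycles_rec\<close> is the
  recursion \<open>sum_lr_wt_rec\<close> for words. Unfolding both gives Foata's correspondence, in which
  the cycles are written one after the other in decreasing order of their minima.
\<close>

lemma sum_cycles_eq_sum_lr_wt: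
  assumes "finite A"
  shows "(\<Sum>\<sigma> | \<sigma> permutes A. \<Prod>C\<in>cycles_on A \<sigma>. x * avoid_wt y C) =
         (\<Sum>w\<in>permutations_of_set A. lr_wt x y w)"
  using assms
proof (induction A rule: finite_psubset_induct)
  case (psubset A)
  show ?case
  proof (cases "A = {}")
    case True
    then show ?thesis
      by (simp add: cycles_on_def lr_wt_def)
  next
    case False
    define a where "a = Min A"
    have a: "a \<in> A" "\<And>b. b \<in> A \<Longrightarrow> a \<le> b"
      using psubset.hyps False by (auto simp: a_def)
    have "(\<Sum>\<sigma> | \<sigma> permutes A. \<Prod>C\<in>cycles_on A \<sigma>. x * avoid_wt y C) =
      (\<Sum>B\<in>Pow (A - {a}). (\<Sum>\<tau> | \<tau> permutes B. \<Prod>C\<in>cycles_on B \<tau>. x * avoid_wt y C) *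
          (\<Sum>v\<in>permutations_of_set (A - {a} - B). x * avoid_wt y (a # v)))"
      using psubset.hyps a by (rule sum_cycles_rec)
    also have "\<dots> = (\<Sum>B\<in>Pow (A - {a}). (\<Sum>u\<in>permutations_of_set B. lr_wt x y u) *
          (\<Sum>v\<in>permutations_of_set (A - {a} - B). x * avoid_wt y (a # v)))"
    proof (rule sum.cong[OF refl])
      fix B assume "B \<in> Pow (A - {a})"
      then have "B \<subset> A"
        using a(1) by blast
      then show "(\<Sum>\<tau> | \<tau> permutes B. \<Prod>C\<in>cycles_on B \<tau>. x * avoid_wt y C) *
          (\<Sum>v\<in>permutations_of_set (A - {a} - B). x * avoid_wt y (a # v)) =
          (\<Sum>u\<in>permutations_of_set B. lr_wt x y u) *
          (\<Sum>v\<in>permutations_of_set (A - {a} - B). x * avoid_wt y (a # v))"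
        by (simp only: psubset.IH)
    qed
    also have "\<dots> = (\<Sum>w\<in>permutations_of_set A. lr_wt x y w)"
      using psubset.hyps a by (rule sum_lr_wt_rec[symmetric])
    finally show ?thesis .
  qed
qed

section \<open>Cycle matches\<close>

lemma length_1324: "length [1 :: nat, 3, 2, 4] = 4"
  by simp

text \<open>
  A match that wraps around the end of the cycle contains the minimum \<open>c\<close> at its second,
  third or fourth place, although its first letter has to be its smallest.
\<close>

lemma cycle_match_iff:
  assumes "\<And>e. e \<in> set C \<Longrightarrow> c \<le> e" "C = c # v"
  shows "(\<exists>r. cycle_match_at [1, 3, 2, 4] C r) \<longleftrightarrow> has_1324 C"
proof
  assume "has_1324 C"
  then obtain i where "match_at [1, 3, 2, 4] C i"
    unfolding has_1324_def ..
  then have i: "i + 4 \<le> length C" "red (take 4 (drop i C)) = [1, 3, 2, 4]"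
    unfolding match_at_def length_1324 by blast+
  have "map (\<lambda>k. C ! ((i + k) mod length C)) [0..<4] = take 4 (drop i C)"
    using i(1) by (intro nth_equalityI) auto
  then have "red (map (\<lambda>k. C ! ((i + k) mod length C)) [0..<4]) = [1, 3, 2, 4]"
    using i(2) by (simp only:)
  moreover have "4 \<le> length C"
    using i(1) by simp
  ultimately show "\<exists>r. cycle_match_at [1, 3, 2, 4] C r"
    unfolding cycle_match_at_def length_1324 by blast
next
  let ?l = "length C"
  assume "\<exists>r. cycle_match_at [1, 3, 2, 4] C r"
  then obtain r where len: "4 \<le> ?l"
    and red: "red (map (\<lambda>k. C ! ((r + k) mod ?l)) [0..<4]) = [1, 3, 2, 4]"
    unfolding cycle_match_at_def length_1324 by blast
  define s where "s = r mod ?l"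
  define e where "e k = C ! ((s + k) mod ?l)" for k
  have "s < ?l"
    using len by (auto simp: s_def intro: mod_less_divisor)
  have "map (\<lambda>k. C ! ((r + k) mod ?l)) [0..<4] = map e [0..<4]"
    by (simp only: e_def[abs_def] s_def mod_add_left_eq)
  also have "\<dots> = [e 0, e 1, e 2, e 3]"
    by (simp add: numeral_eq_Suc)
  finally have "map (\<lambda>k. C ! ((r + k) mod ?l)) [0..<4] = [e 0, e 1, e 2, e 3]" .
  then have lt: "e 0 < e 2" "e 2 < e 1" "e 1 < e 3"
    using red red_eq_1324_iff by metis+
  have "s + 3 < ?l"
  proof (rule ccontr)
    assume "\<not> s + 3 < ?l"
    with \<open>s < ?l\<close> have "?l - s = 1 \<or> ?l - s = 2 \<or> ?l - s = 3" "s + (?l - s) = ?l"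
      by linarith+
    moreover have "e 0 < e 1" "e 0 < e 3"
      using lt by linarith+
    ultimately have "e 0 < e (?l - s)"
      using lt(1) by metis
    moreover have "e (?l - s) = c"
      using \<open>s + (?l - s) = ?l\<close> assms(2) unfolding e_def by simp
    moreover have "c \<le> e 0"
      using \<open>s < ?l\<close> by (intro assms(1)) (simp add: e_def)
    ultimately show False by simp
  qed
  then have "take 4 (drop s C) = [e 0, e 1, e 2, e 3]"
    by (intro nth_equalityI) (auto simp: e_def less_Suc_eq numeral_eq_Suc)
  then have "red (take 4 (drop s C)) = [1, 3, 2, 4]"
    using lt red_eq_1324_iff[of "e 0" "e 1" "e 2" "e 3"] by (simp only:)
  moreover have "s + 4 \<le> ?l"
    using \<open>s + 3 < ?l\<close> by simp
  ultimately have "match_at [1, 3, 2, 4] C s"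
    unfolding match_at_def length_1324 by (intro conjI)
  then show "has_1324 C"
    by (auto simp: has_1324_def)
qed

lemma cycles_of_eq: "cycles_of n \<sigma> = cycles_on {1..n} \<sigma>"
  by (simp add: cycles_of_def cycles_on_def)

lemma prod_cycles_eq:
  assumes "\<sigma> permutes {1..n}"
  shows "(\<Prod>C\<in>cycles_on {1..n} \<sigma>. x * avoid_wt y C) =
    (if \<sigma> \<in> NCM_set [1, 3, 2, 4] n then x ^ cyc n \<sigma> * y ^ cdes n \<sigma> else 0)"
proof -
  let ?Z = "cycles_on {1..n} \<sigma>"
  have p: "permutation \<sigma>"
    using assms by (intro permutation_if_permutes[of "{1..n}"]) auto
  have Z: "C \<noteq> [] \<and> ((\<exists>r. cycle_match_at [1, 3, 2, 4] C r) \<longleftrightarrow> has_1324 C)" if "C \<in> ?Z" for C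
  proof -
    from that obtain c where c: "C = support \<sigma> c" "\<forall>d\<in>set (support \<sigma> c). c \<le> d"
      unfolding cycles_on_def by blast
    obtain v where C: "C = c # v"
      using support_Cons[OF p, of c] c(1) by metis
    have "(\<exists>r. cycle_match_at [1, 3, 2, 4] C r) \<longleftrightarrow> has_1324 C"
      using c(2) unfolding c(1)[symmetric] by (intro cycle_match_iff[OF _ C]) blast
    then show ?thesis
      using C by blast
  qed
  have NCM: "\<sigma> \<in> NCM_set [1, 3, 2, 4] n \<longleftrightarrow> (\<forall>C\<in>?Z. \<not> has_1324 C)"
    using assms Z unfolding NCM_set_def cycles_of_eq by blast
  show ?thesis
  proof (cases "\<sigma> \<in> NCM_set [1, 3, 2, 4] n")
    case True
    then have "(\<Prod>C\<in>?Z. x * avoid_wt y C) = (\<Prod>C\<in>?Z. x * y ^ (1 + des C))"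
      using NCM Z by (intro prod.cong refl) (simp add: avoid_wt_eq)
    also have "\<dots> = x ^ cyc n \<sigma> * y ^ cdes n \<sigma>"
      by (simp only: prod.distrib prod_constant power_sum cyc_def cdes_def cycles_of_eq)
    finally show ?thesis
      using True by simp
  next
    case False
    then obtain C where "C \<in> ?Z" "has_1324 C"
      using NCM by blast
    then have "x * avoid_wt y C = 0"
      using Z[of C] by (simp add: avoid_wt_eq)
    then show ?thesis
      using False \<open>C \<in> ?Z\<close> by (auto simp: finite_cycles_on intro!: prod_zero)
  qed
qed

lemma NCM_eq_egf: "NCM [1, 3, 2, 4] x y = egf (lr_wt x y)"
proof (rule fps_ext)
  fix n
  show "NCM [1, 3, 2, 4] x y $ n = egf (lr_wt x y) $ n"
  proof (cases "n = 0")
    case True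
    then show ?thesis
      by (simp add: NCM_def egf_def lr_wt_def)
  next
    case False
    have fin: "finite {\<sigma>. \<sigma> permutes {1..n}}"
      by (rule finite_permutations) simp
    have sub: "NCM_set [1, 3, 2, 4] n \<subseteq> {\<sigma>. \<sigma> permutes {1..n}}"
      by (auto simp: NCM_set_def)
    have "(\<Sum>\<sigma>\<in>NCM_set [1, 3, 2, 4] n. x ^ cyc n \<sigma> * y ^ cdes n \<sigma>) =
        (\<Sum>\<sigma>\<in>NCM_set [1, 3, 2, 4] n. \<Prod>C\<in>cycles_on {1..n} \<sigma>. x * avoid_wt y C)"
    proof (rule sum.cong[OF refl])
      fix \<sigma> assume "\<sigma> \<in> NCM_set [1, 3, 2, 4] n"
      moreover from this sub have "\<sigma> permutes {1..n}" by blast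
      ultimately show "x ^ cyc n \<sigma> * y ^ cdes n \<sigma> = (\<Prod>C\<in>cycles_on {1..n} \<sigma>. x * avoid_wt y C)"
        by (simp only: prod_cycles_eq if_True)
    qed
    also have "\<dots> = (\<Sum>\<sigma> | \<sigma> permutes {1..n}. \<Prod>C\<in>cycles_on {1..n} \<sigma>. x * avoid_wt y C)"
      using fin sub
    proof (rule sum.mono_neutral_left, intro ballI)
      fix \<sigma> assume "\<sigma> \<in> {\<sigma>. \<sigma> permutes {1..n}} - NCM_set [1, 3, 2, 4] n"
      then show "(\<Prod>C\<in>cycles_on {1..n} \<sigma>. x * avoid_wt y C) = 0"
        by (simp only: Diff_iff mem_Collect_eq prod_cycles_eq if_False)
    qed
    also have "\<dots> = (\<Sum>w\<in>permutations_of_set {..<n}. lr_wt x y w)"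
      using sum_words_card[OF order_invariant_lr_wt, of "{1..n}" x y]
      by (simp add: sum_cycles_eq_sum_lr_wt)
    finally show ?thesis
      using False by (simp add: NCM_def egf_def)
  qed
qed

theorem theorem7:
  fixes x y :: "'a::field_char_0"
  shows "NCM [1, 3, 2, 4] x y = NM [1, 3, 2, 4] x y \<and>
         NM [1, 3, 2, 4] x y = fps_recip_power (U1324 y) x"
  by (simp only: NCM_eq_egf NM_eq_egf egf_lr_wt_eq_recip_power simp_thms)

end
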